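(* Let $G$ be a connected graph with $n$ vertices, where $n\ge 5$. The following are equivalent: (i) $G$ is either a complete graph or a cycle; (ii) $\mathrm{s}(G,w)\ge \frac{w(G)}{2}$ for every $w\in\mathcal{W}(G)$; (iii) $G-\{u,v\}$ is disconnected for any two (distinct) nonadjacent vertices $u$ and $v$ of $G$; (iv) $q_{1,1}(G)=q_{n-1,1}(G)$ and $q_{2,1}(G)=q_{n-2,1}(G)$.
   Context: All graphs are finite, simple and undirected. For a graph $G$ and $S\subset V(G)$, $G[S]$ is the subgraph induced by $S$ and $G-S=G[V(G)\setminus S]$. "Component" means connected component (often identified with its vertex set), and $k(H)$ is the number of components of a graph $H$. A weight function $w$ on $V(G)$ is a map assigning a positive real number to each vertex; $\mathcal{W}(G)$ is the set of all weight functions on $V(G)$. For $X\subset V(G)$, $w(X)=\sum_{v\in X}w(v)$, and $w(G)=w(V(G))$. For disjoint $A,B\subset V(G)$, $E(A,B)$ is the set of edges joining a vertex of $A$ to a vertex of $B$. A non-empty subset $S\subset V(G)$ is a weighted safe set of $(G,w)$ if for every component $C$ of $G[S]$ and every component $D$ of $G-S$, $w(C)\ge w(D)$ whenever $E(C,D)\neq\emptyset$. The weighted safe number is $\mathrm{s}(G,w)=\min\{w(S)\mid S$ is a weighted safe set of $(G,w)\}$. For positive integers $i,j$, $q_{i,j}(G)=|\{X\subset V(G)\mid |X|=i \text{ and } k(G[X])=j\}|$. *)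

theory Defs
  imports Complex_Main "Graph_Theory.Graph_Theory"
begin

text \<open>
  Finite simple undirected graphs are the symmetric, loop-free digraphs without parallel arcs of
  the locale \<open>graph\<close>: an edge \<open>uv\<close> is represented by the two arcs from \<open>u\<close> to \<open>v\<close> and from \<open>v\<close>
  to \<open>u\<close>.  Hence strong components are the connected components.  They are identified with their
  vertex sets, \<open>sccs_verts\<close>.  The induced subgraph on \<open>S\<close> is \<open>G \<restriction> S\<close>, so
  deleting the vertex set \<open>S\<close> gives \<open>G \<restriction> (verts G - S)\<close>.
\<close>

text \<open>The name \<open>connected\<close> also denotes the topological notion, so the graph-theoretic one gets an alias.\<close>

abbreviation connected_graph :: "('a, 'b) pre_digraph \<Rightarrow> bool" where
  "connected_graph G \<equiv> Digraph_Component.connected G"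

abbreviation components :: "('a, 'b) pre_digraph \<Rightarrow> 'a set set" where
  "components G \<equiv> pre_digraph.sccs_verts G"

abbreviation num_components :: "('a, 'b) pre_digraph \<Rightarrow> nat" where
  "num_components G \<equiv> card (components G)"

abbreviation complete_graph :: "('a, 'b) pre_digraph \<Rightarrow> bool" where
  "complete_graph G \<equiv> complete_digraph (card (verts G)) G"

definition cycle_graph :: "('a, 'b) pre_digraph \<Rightarrow> bool" where
  "cycle_graph G \<longleftrightarrow> graph G \<and> 3 \<le> card (verts G) \<and>
     (\<exists>c :: nat \<Rightarrow> 'a. bij_betw c {..<card (verts G)} (verts G) \<and>
        arcs_ends G = (\<Union>i<card (verts G).
          {(c i, c (Suc i mod card (verts G))), (c (Suc i mod card (verts G)), c i)}))"

text \<open>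
  Values outside \<open>verts G\<close> are unconstrained; nothing below depends on them.
\<close>

definition weight_functions :: "('a, 'b) pre_digraph \<Rightarrow> ('a \<Rightarrow> real) set" where
  "weight_functions G = {w. \<forall>v\<in>verts G. 0 < w v}"

text \<open>
  For disjoint \<open>A\<close> and \<open>B\<close>, each edge joining them has exactly one of its two arcs
  directed from \<open>A\<close> to \<open>B\<close>.
\<close>

definition edges_between :: "('a, 'b) pre_digraph \<Rightarrow> 'a set \<Rightarrow> 'a set \<Rightarrow> 'b set" where
  "edges_between G A B = {e \<in> arcs G. tail G e \<in> A \<and> head G e \<in> B}"

definition weighted_safe_set ::
    "('a, 'b) pre_digraph \<Rightarrow> ('a \<Rightarrow> real) \<Rightarrow> 'a set \<Rightarrow> bool" where
  "weighted_safe_set G w S \<longleftrightarrow> S \<noteq> {} \<and> S \<subseteq> verts G \<and>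
     (\<forall>C \<in> components (G \<restriction> S). \<forall>D \<in> components (G \<restriction> (verts G - S)).
        edges_between G C D \<noteq> {} \<longrightarrow> sum w C \<ge> sum w D)"

text \<open>
  For a finite graph with at least one vertex the minimum is over a finite set, nonempty by
  \<open>weighted_safe_set_verts\<close> below.
\<close>

definition weighted_safe_number :: "('a, 'b) pre_digraph \<Rightarrow> ('a \<Rightarrow> real) \<Rightarrow> real" where
  "weighted_safe_number G w = Min {sum w S | S. weighted_safe_set G w S}"

definition q :: "nat \<Rightarrow> nat \<Rightarrow> ('a, 'b) pre_digraph \<Rightarrow> nat" where
  "q i j G = card {X. X \<subseteq> verts G \<and> card X = i \<and> num_components (G \<restriction> X) = j}"

lemma weighted_safe_set_verts:
  assumes "verts G \<noteq> {}"
  shows "weighted_safe_set G w (verts G)"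
proof -
  have "D = {}" if "D \<in> components (G \<restriction> {})" for D
  proof (rule ccontr)
    assume "D \<noteq> {}"
    then obtain u where "u \<in> D" by blast
    with that have "u \<rightarrow>\<^sup>*\<^bsub>G \<restriction> {}\<^esub> u"
      by (auto simp: pre_digraph.sccs_verts_def)
    then show False
      by (auto simp: reachable_def elim: rtrancl_on.cases)
  qed
  with assms show ?thesis
    by (auto simp: weighted_safe_set_def edges_between_def)
qed

end

theory Submission
  imports Defs
begin

text \<open>
  Condition (iii) is the hub: (ii) and (iv) each imply it, it implies (i), and (i) implies the
  other three.

  (iii) implies (i): take a longest path.  A vertex outside it is adjacent to neither end, so
  deleting the two ends would leave a connected graph, namely the rest of the path with everything
  else still attached to it.  By (iii) the ends are adjacent, so the path closes up.  A vertex
  attached to this closed path would give a longer path, hence the cycle is Hamiltonian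
  (\<open>hamiltonian_cycle_if_nonadj_cut\<close>).  Number the vertices along it as \<open>c 0, c 1, ...\<close>.
  Two vertices are adjacent as soon as the two arcs left by their deletion are joined by an
  edge.  A chord from \<open>c i\<close> to \<open>c (i + d)\<close> joins the arcs left by deleting the successors of its ends,
  so chords may be rotated; and its rotation by two joins the arcs left by deleting
  \<open>c i\<close> and \<open>c (i + d + 1)\<close>, so chords may be lengthened.  A chord of length \<open>d\<close> is also one of length
  \<open>n - d\<close>, so a single chord forces all of them: the graph is a bare cycle or complete.

  (ii) implies (iii): if \<open>u\<close>, \<open>v\<close> are nonadjacent and their deletion leaves a connected set \<open>X\<close>, give \<open>u\<close> and
  \<open>v\<close> weight 1 each and \<open>X\<close> total weight 1.  Then \<open>X\<close> is a safe set with a third of the weight.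

  (iv) implies (iii): the first equation of (iv) says that there is no cut vertex.  The second one says,
  after cancelling the pairs that both sides count, that there are as many separating edges
  (adjacent pairs whose deletion disconnects) as nonseparating nonedges.  Without cut vertices, any
  two vertices on different sides of a separating edge form a nonseparating nonedge.  Some vertex \<open>r\<close>
  lies on no separating edge.  Choose for each separating edge a side that avoids \<open>r\<close>.  In every
  nonempty family of separating edges, a largest chosen side is not covered by the others
  (\<open>private_element_of_largest_side\<close>), so the chosen sides contain together at least as many vertices as there
  are separating edges, and each of these vertices forms a nonseparating nonedge with \<open>r\<close>.  From
  five vertices on, there is always one more nonseparating nonedge
  (\<open>card_separating_edges_less\<close>), unless there are no separating edges.  So neither kind of pair
  occurs, which is (iii).

  (i) implies the rest: only cycles need an argument.  Deleting two vertices of a cycle leaves one arc if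
  they are adjacent and two otherwise, which gives (iii) and (iv).  For (ii), send each component
  of \<open>G - S\<close> to the component of \<open>G[S]\<close> just before it on the cycle.  This map is injective and, for a
  safe \<open>S\<close>, does not decrease weights (\<open>weighted_safe_set_half\<close>).
\<close>


section \<open>Connected vertex sets\<close>

context graph
begin

lemma adj_sym: "u \<rightarrow>\<^bsub>G\<^esub> v \<Longrightarrow> v \<rightarrow>\<^bsub>G\<^esub> u"
  by (rule graph_symmetric)

lemma adj_neq: "u \<rightarrow>\<^bsub>G\<^esub> v \<Longrightarrow> u \<noteq> v"
  using adj_not_same by blast

definition no_edge :: "'a set \<Rightarrow> 'a set \<Rightarrow> bool" where
  "no_edge A B \<longleftrightarrow> (\<forall>a\<in>A. \<forall>b\<in>B. \<not> a \<rightarrow>\<^bsub>G\<^esub> b)"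

text \<open>
  Connectedness in terms of cuts instead of walks: proofs below show that a set is connected by
  finding an edge that leaves a given part of it, and disconnected by exhibiting a part that none leaves.
  \<open>connected_induce_iff\<close> reconciles this with the connectedness of induced subgraphs.
\<close>

definition conn_set :: "'a set \<Rightarrow> bool" where
  "conn_set X \<longleftrightarrow> X \<noteq> {} \<and> (\<forall>A\<subseteq>X. A \<noteq> {} \<and> no_edge A (X - A) \<longrightarrow> A = X)"

lemma no_edge_sym: "no_edge A B \<Longrightarrow> no_edge B A"
  unfolding no_edge_def using adj_sym by blast

lemma conn_setD:
  assumes "conn_set X" "A \<subseteq> X" "A \<noteq> {}" "A \<noteq> X"
  obtains a b where "a \<in> A" "b \<in> X - A" "a \<rightarrow>\<^bsub>G\<^esub> b"
  using assms unfolding conn_set_def no_edge_def by blast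

lemma conn_set_one_side:
  assumes "conn_set X" "X \<subseteq> A \<union> B" "no_edge A B"
  shows "X \<subseteq> A \<or> X \<subseteq> B"
proof (cases "X \<inter> A = {}")
  case False
  have "no_edge (X \<inter> A) (X - X \<inter> A)"
    using assms unfolding no_edge_def by blast
  with False assms(1) have "X \<inter> A = X"
    unfolding conn_set_def by blast
  then show ?thesis by blast
qed (use assms in blast)

text \<open>
  Of the two parts of a cut of \<open>X\<close>, one avoids the connected set \<open>I\<close>, and edges are symmetric.  So only
  parts \<open>B\<close> away from \<open>I\<close> have to be examined.
\<close>

lemma conn_set_extend:
  assumes "conn_set I" "I \<subseteq> X"
    and out: "\<And>B. B \<subseteq> X - I \<Longrightarrow> B \<noteq> {} \<Longrightarrow> \<exists>b\<in>B. \<exists>x\<in>X - B. b \<rightarrow>\<^bsub>G\<^esub> x"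
  shows "conn_set X"
  unfolding conn_set_def
proof (intro conjI allI impI)
  show "X \<noteq> {}" using assms unfolding conn_set_def by blast
next
  fix A assume A: "A \<subseteq> X" "A \<noteq> {} \<and> no_edge A (X - A)"
  have "I \<subseteq> A \<or> I \<subseteq> X - A"
    using conn_set_one_side[OF assms(1), of A "X - A"] A assms(2) by blast
  then show "A = X"
  proof
    assume "I \<subseteq> A"
    moreover have "no_edge (X - A) A" using A no_edge_sym by blast
    ultimately show ?thesis
      using out[of "X - A"] A unfolding no_edge_def by blast
  next
    assume "I \<subseteq> X - A"
    then show ?thesis
      using out[of A] A unfolding no_edge_def by blast
  qed
qed

lemma conn_set_singleton: "conn_set {x}"
  unfolding conn_set_def by blast

lemma conn_set_pair:
  assumes "u \<noteq> v" shows "conn_set {u, v} \<longleftrightarrow> u \<rightarrow>\<^bsub>G\<^esub> v"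
proof
  assume "conn_set {u, v}"
  then show "u \<rightarrow>\<^bsub>G\<^esub> v"
    using assms by (auto elim: conn_setD[where A = "{u}"])
next
  assume "u \<rightarrow>\<^bsub>G\<^esub> v"
  show "conn_set {u, v}"
  proof (rule conn_set_extend[OF conn_set_singleton[of u]])
    fix B assume B: "B \<subseteq> {u, v} - {u}" "B \<noteq> {}"
    then have "B = {v}" by blast
    then show "\<exists>b\<in>B. \<exists>x\<in>{u, v} - B. b \<rightarrow>\<^bsub>G\<^esub> x"
      using \<open>u \<rightarrow>\<^bsub>G\<^esub> v\<close> adj_sym assms by blast
  qed simp
qed

lemma conn_set_Un:
  assumes X: "conn_set X" and Y: "conn_set Y"
    and xy: "x \<in> X" "y \<in> Y" "x = y \<or> x \<rightarrow>\<^bsub>G\<^esub> y"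
  shows "conn_set (X \<union> Y)"
proof (rule conn_set_extend[OF X])
  fix B assume B: "B \<subseteq> X \<union> Y - X" "B \<noteq> {}"
  show "\<exists>b\<in>B. \<exists>z\<in>X \<union> Y - B. b \<rightarrow>\<^bsub>G\<^esub> z"
  proof (cases "B = Y")
    case True
    then have "x \<rightarrow>\<^bsub>G\<^esub> y" using B xy by blast
    then show ?thesis using adj_sym B xy True by blast
  next
    case False
    then obtain b z where "b \<in> B" "z \<in> Y - B" "b \<rightarrow>\<^bsub>G\<^esub> z"
      using conn_setD[OF Y, of B] B by blast
    then show ?thesis by blast
  qed
qed simp

lemma conn_set_walk:
  assumes "a < b" "\<And>k. a \<le> k \<Longrightarrow> Suc k < b \<Longrightarrow> c k \<rightarrow>\<^bsub>G\<^esub> c (Suc k)"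
  shows "conn_set (c ` {a..<b})"
  using Suc_leI[OF assms(1)] assms(2)
proof (induction rule: dec_induct)
  case base
  show ?case by (simp add: conn_set_singleton)
next
  case (step m)
  have "c (m - 1) \<rightarrow>\<^bsub>G\<^esub> c m" using step.prems[of "m - 1"] step.hyps by simp
  then have "conn_set (c ` {a..<m} \<union> {c m})"
    by (intro conn_set_Un[of _ _ "c (m - 1)" "c m"])
      (use step conn_set_singleton in auto)
  then show ?case using step.hyps by (simp add: atLeastLessThanSuc)
qed

lemma conn_set_path:
  assumes "successively (\<lambda>u v. u \<rightarrow>\<^bsub>G\<^esub> v) p" "p \<noteq> []"
  shows "conn_set (set p)"
  using assms
proof (induction p)
  case (Cons a p)
  show ?case
  proof (cases "p = []")
    case False
    have "conn_set ({a} \<union> set p)"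
      by (rule conn_set_Un[of _ _ a "hd p"])
        (use False Cons conn_set_singleton in \<open>auto simp: successively_Cons\<close>)
    then show ?thesis by simp
  qed (simp add: conn_set_singleton)
qed simp

lemma adj_induce_iff: "u \<rightarrow>\<^bsub>G \<restriction> X\<^esub> v \<longleftrightarrow> u \<in> X \<and> v \<in> X \<and> u \<rightarrow>\<^bsub>G\<^esub> v"
  by (auto simp: arcs_ends_conv)

lemma symmetric_induce: "symmetric (G \<restriction> X)"
  by (auto simp: symmetric_def sym_def adj_induce_iff intro: adj_sym)

text \<open>
  The set of vertices reachable from \<open>u\<close> inside \<open>X\<close> is a part that no edge leaves.
\<close>

lemma conn_set_iff_reachable:
  "conn_set X \<longleftrightarrow> X \<noteq> {} \<and> (\<forall>u\<in>X. \<forall>v\<in>X. u \<rightarrow>\<^sup>*\<^bsub>G \<restriction> X\<^esub> v)"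
proof -
  interpret X: wf_digraph "G \<restriction> X" by (rule wellformed_induce_subgraph)
  show ?thesis
  proof (intro iffI conjI ballI)
    fix u v assume conn: "conn_set X" and uv: "u \<in> X" "v \<in> X"
    let ?A = "{y. u \<rightarrow>\<^sup>*\<^bsub>G \<restriction> X\<^esub> y}"
    have "?A \<subseteq> X" using X.reachable_in_verts by auto
    moreover have "no_edge ?A (X - ?A)"
      unfolding no_edge_def
    proof (intro ballI notI)
      fix a b assume ab: "a \<in> ?A" "b \<in> X - ?A" "a \<rightarrow>\<^bsub>G\<^esub> b"
      then have "a \<rightarrow>\<^bsub>G \<restriction> X\<^esub> b"
        using \<open>?A \<subseteq> X\<close> adj_induce_iff by blast
      then show False using ab X.reachable_adj_trans by blast
    qed
    moreover have "u \<in> ?A" using uv by simp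
    ultimately have "?A = X" using conn unfolding conn_set_def by blast
    then show "u \<rightarrow>\<^sup>*\<^bsub>G \<restriction> X\<^esub> v" using uv by blast
  next
    assume "conn_set X" then show "X \<noteq> {}" unfolding conn_set_def by blast
  next
    assume R: "X \<noteq> {} \<and> (\<forall>u\<in>X. \<forall>v\<in>X. u \<rightarrow>\<^sup>*\<^bsub>G \<restriction> X\<^esub> v)"
    have "A = X" if A: "A \<subseteq> X" "A \<noteq> {}" "no_edge A (X - A)" for A
    proof -
      obtain a where a: "a \<in> A" using A by blast
      have "y \<in> A" if "a \<rightarrow>\<^sup>*\<^bsub>G \<restriction> X\<^esub> y" for y
        using that
      proof (induction rule: X.reachable_induct)
        case (step x y)
        then show ?case using A unfolding no_edge_def adj_induce_iff by blast
      qed (use a in simp)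
      then show ?thesis using R A a by blast
    qed
    with R show "conn_set X" unfolding conn_set_def by blast
  qed
qed

lemma connected_induce_iff: "connected_graph (G \<restriction> X) \<longleftrightarrow> conn_set X"
proof -
  interpret X: wf_digraph "G \<restriction> X" by (rule wellformed_induce_subgraph)
  have "connected_graph (G \<restriction> X) \<longleftrightarrow> strongly_connected (G \<restriction> X)"
    unfolding Digraph_Component.connected_def
    by (simp add: strongly_connected_def X.reachable_mk_symmetric_eq symmetric_induce)
  then show ?thesis
    by (simp add: strongly_connected_def conn_set_iff_reachable)
qed

text \<open>
  Rids components of reachability as well: since arcs come in both directions, a strong component is closed under
  all arcs that start in it.
\<close>

lemma components_induce:
  "components (G \<restriction> X) = {C. C \<subseteq> X \<and> conn_set C \<and> no_edge C (X - C)}"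
proof -
  interpret X: wf_digraph "G \<restriction> X" by (rule wellformed_induce_subgraph)
  interpret X: sym_digraph "G \<restriction> X" by (rule X.sym_digraphI[OF symmetric_induce])
  show ?thesis
  proof (intro equalityI subsetI)
    fix C assume C: "C \<in> components (G \<restriction> X)"
    have CX: "C \<subseteq> X" using X.sccs_verts_subsets[OF C] by simp
    have closed: "v \<in> C" if "u \<in> C" "u \<rightarrow>\<^sup>*\<^bsub>G \<restriction> X\<^esub> v" for u v
      using C that X.symmetric_reachable' unfolding X.sccs_verts_def by blast
    have "A = C" if A: "A \<subseteq> C" "A \<noteq> {}" "no_edge A (C - A)" for A
    proof -
      obtain a where a: "a \<in> A" using A by blast
      have "y \<in> A" if "a \<rightarrow>\<^sup>*\<^bsub>G \<restriction> X\<^esub> y" for y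
        using that
      proof (induction rule: X.reachable_induct)
        case (step x y)
        then have "y \<in> C" using closed A by blast
        then show ?case using A step unfolding no_edge_def adj_induce_iff by blast
      qed (use a in simp)
      moreover have "\<forall>y\<in>C. a \<rightarrow>\<^sup>*\<^bsub>G \<restriction> X\<^esub> y"
        using C a A unfolding X.sccs_verts_def by blast
      ultimately show ?thesis using A by blast
    qed
    moreover have "C \<noteq> {}" using C unfolding X.sccs_verts_def by blast
    moreover have "no_edge C (X - C)"
      unfolding no_edge_def
      using closed CX adj_induce_iff X.reachable_adjI by blast
    ultimately show "C \<in> {C. C \<subseteq> X \<and> conn_set C \<and> no_edge C (X - C)}"
      using CX unfolding conn_set_def by blast
  next
    fix C assume "C \<in> {C. C \<subseteq> X \<and> conn_set C \<and> no_edge C (X - C)}"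
    then have C: "C \<subseteq> X" "conn_set C" "no_edge C (X - C)" by auto
    interpret C: wf_digraph "G \<restriction> C" by (rule wellformed_induce_subgraph)
    have mono: "u \<rightarrow>\<^sup>*\<^bsub>G \<restriction> X\<^esub> v" if "u \<rightarrow>\<^sup>*\<^bsub>G \<restriction> C\<^esub> v" for u v
      using that
    proof (induction rule: C.reachable_induct)
      case (step x y)
      then have "x \<rightarrow>\<^bsub>G \<restriction> X\<^esub> y" using C(1) by (auto simp: adj_induce_iff)
      with step.IH show ?case by (rule X.reachable_adj_trans)
    qed (use C in auto)
    have closed: "v \<in> C" if "u \<rightarrow>\<^sup>*\<^bsub>G \<restriction> X\<^esub> v" "u \<in> C" for u v
      using that
    proof (induction rule: X.reachable_induct)
      case (step x y)
      then show ?case using C(3) by (auto simp: no_edge_def adj_induce_iff)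
    qed simp
    show "C \<in> components (G \<restriction> X)"
      using C(2) mono closed unfolding X.sccs_verts_def conn_set_iff_reachable by blast
  qed
qed

lemma in_component:
  assumes "x \<in> X" obtains C where "x \<in> C" "C \<in> components (G \<restriction> X)"
proof -
  interpret X: wf_digraph "G \<restriction> X" by (rule wellformed_induce_subgraph)
  show ?thesis
    using that X.in_scc_of_self X.scc_of_in_sccs_verts assms by (metis induce_subgraph_verts)
qed

lemma Union_components: "\<Union>(components (G \<restriction> X)) = X"
  using in_component[of _ X] components_induce by blast

lemma components_disjoint:
  assumes "C \<in> components (G \<restriction> X)" "D \<in> components (G \<restriction> X)" "C \<noteq> D"
  shows "C \<inter> D = {}"
proof -
  interpret X: wf_digraph "G \<restriction> X" by (rule wellformed_induce_subgraph)
  show ?thesis using X.sccs_verts_disjoint assms by blast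
qed

lemma sum_components:
  assumes "X \<subseteq> verts G"
  shows "sum w X = (\<Sum>C\<in>components (G \<restriction> X). sum w C)"
proof -
  have sub: "C \<subseteq> X" if "C \<in> components (G \<restriction> X)" for C
    using that Union_components by blast
  have "finite X" using finite_subset[OF assms finite_verts] .
  then have "sum w (\<Union>(components (G \<restriction> X))) = (\<Sum>C\<in>components (G \<restriction> X). sum w C)"
    using components_disjoint finite_subset[OF sub]
    by (intro sum.Union_disjoint[unfolded comp_def]) blast+
  then show ?thesis by (simp add: Union_components)
qed

lemma components_conn_set:
  assumes "conn_set X" shows "components (G \<restriction> X) = {X}"
proof -
  have "X \<in> components (G \<restriction> X)"
    using assms unfolding components_induce by (auto simp: no_edge_def)
  moreover have "C = X" if "C \<in> components (G \<restriction> X)" for C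
    using that assms unfolding components_induce conn_set_def by blast
  ultimately show ?thesis by blast
qed

lemma num_components_eq_1_iff: "num_components (G \<restriction> X) = 1 \<longleftrightarrow> conn_set X"
proof
  assume "num_components (G \<restriction> X) = 1"
  then obtain C where C: "components (G \<restriction> X) = {C}" by (auto simp: card_1_singleton_iff)
  then have "X = C" using Union_components[of X] by simp
  then show "conn_set X" using C components_induce[of X] by blast
qed (simp add: components_conn_set)

end

section \<open>Chords of a Hamiltonian cycle\<close>

text \<open>
  The cycle is numbered periodically over all natural numbers.  So every arc is the image of an interval,
  and a rotation only changes the starting point.
\<close>

locale hamiltonian_cycle = graph +
  fixes c :: "nat \<Rightarrow> 'a" and n :: nat
  assumes cycle_eq_iff: "c i = c j \<longleftrightarrow> i mod n = j mod n"
    and range_cycle: "range c = verts G"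
    and cycle_adj: "c i \<rightarrow>\<^bsub>G\<^esub> c (Suc i)"
    and length_ge_3: "3 \<le> n"
begin

lemma cycle_periodic: "c (i + n) = c i" "c (i + n * k) = c i"
  by (auto simp: cycle_eq_iff)

lemma cycle_shift: "c i = c j \<Longrightarrow> c (Suc i) = c (Suc j)"
  by (simp add: cycle_eq_iff) (metis mod_Suc_eq)

text \<open>
  Any \<open>n\<close> consecutive indices enumerate the vertices exactly once, so a statement about the whole cycle
  can be read off from the window starting at a convenient vertex.
\<close>

lemma inj_on_window: "inj_on c {i..<i + n}"
proof (rule inj_onI)
  fix k l assume kl: "k \<in> {i..<i + n}" "l \<in> {i..<i + n}" "c k = c l"
  then have eq: "k mod n = l mod n" by (simp add: cycle_eq_iff)
  show "k = l"
  proof (cases "k \<le> l")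
    case True
    then have "n dvd l - k" using eq by (metis mod_eq_dvd_iff_nat)
    then show ?thesis using kl True by (auto dest: dvd_imp_le)
  next
    case False
    then have "n dvd k - l" using eq by (metis mod_eq_dvd_iff_nat nat_le_linear)
    then show ?thesis using kl False by (auto dest: dvd_imp_le)
  qed
qed

lemma window_eq: "c ` {i..<i + n} = verts G"
proof -
  have "c j \<in> c ` {i..<i + n}" for j
  proof
    have "i \<le> n * i" using length_ge_3 by simp
    then have "i + (j + n * i - i) = j + n * i" by linarith
    then have "(i + (j + n * i - i)) mod n = j mod n" by simp
    then show "c j = c (i + (j + n * i - i) mod n)"
      unfolding cycle_eq_iff by (metis mod_add_right_eq)
    show "i + (j + n * i - i) mod n \<in> {i..<i + n}"
      using length_ge_3 by simp
  qed
  then have "c ` {i..<i + n} = range c" by (intro equalityI image_mono image_subsetI) auto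
  then show ?thesis by (simp only: range_cycle)
qed

lemma card_verts_cycle: "card (verts G) = n"
  using card_image[OF inj_on_window[of 0]] window_eq[of 0] by simp

lemma vertex_offset:
  assumes "v \<in> verts G"
  obtains d where "d < n" "v = c (i + d)"
proof -
  have "v \<in> c ` {i..<i + n}" using assms by (simp only: window_eq)
  then obtain k where k: "i \<le> k" "k < i + n" "v = c k" by auto
  then show ?thesis using that[of "k - i"] by simp
qed

lemma vertex_offset':
  assumes "v \<in> verts G" "v \<noteq> c i"
  obtains d where "0 < d" "d < n" "v = c (i + d)"
proof -
  obtain d where d: "d < n" "v = c (i + d)" using vertex_offset[OF assms(1)] .
  then have "d \<noteq> 0" using assms(2) by (intro notI) simp
  then show ?thesis using that d by simp
qed

lemma verts_minus_1: "verts G - {c i} = c ` {Suc i..<i + n}"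
proof -
  have "c ` ({i..<i + n} - {i}) = c ` {i..<i + n} - c ` {i}"
    by (rule inj_on_image_set_diff[OF inj_on_window[of i]]) (use length_ge_3 in auto)
  moreover have "{i..<i + n} - {i} = {Suc i..<i + n}" by auto
  ultimately show ?thesis by (simp add: window_eq)
qed

lemma verts_minus_2:
  assumes "0 < d" "d < n"
  shows "verts G - {c i, c (i + d)} = c ` {Suc i..<i + d} \<union> c ` {Suc (i + d)..<i + n}"
proof -
  have "c ` ({i..<i + n} - {i, i + d}) = c ` {i..<i + n} - c ` {i, i + d}"
    by (rule inj_on_image_set_diff[OF inj_on_window[of i]]) (use assms in auto)
  moreover have "{i..<i + n} - {i, i + d} = {Suc i..<i + d} \<union> {Suc (i + d)..<i + n}"
    using assms by auto
  ultimately show ?thesis by (simp add: window_eq image_Un)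
qed

lemma conn_set_arc: "a < b \<Longrightarrow> conn_set (c ` {a..<b})"
  by (rule conn_set_walk) (auto intro: cycle_adj)

lemma offset_adj_1: "c i \<rightarrow>\<^bsub>G\<^esub> c (i + 1)" "c i \<rightarrow>\<^bsub>G\<^esub> c (i + (n - 1))"
proof -
  show "c i \<rightarrow>\<^bsub>G\<^esub> c (i + 1)" using cycle_adj by simp
  have "Suc (i + (n - 1)) = i + n" using length_ge_3 by simp
  then have "c (i + (n - 1)) \<rightarrow>\<^bsub>G\<^esub> c i"
    using cycle_adj[of "i + (n - 1)"] cycle_periodic(1)[of i] by simp
  then show "c i \<rightarrow>\<^bsub>G\<^esub> c (i + (n - 1))" by (rule adj_sym)
qed

end

locale hamiltonian_cycle_with_cuts = hamiltonian_cycle +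
  assumes nonadj_cut: "\<And>u v. u \<in> verts G \<Longrightarrow> v \<in> verts G \<Longrightarrow> u \<noteq> v \<Longrightarrow> \<not> u \<rightarrow>\<^bsub>G\<^esub> v
    \<Longrightarrow> \<not> conn_set (verts G - {u, v})"
begin

text \<open>
  Deleting \<open>c i\<close> and \<open>c (i + d)\<close> leaves two arcs.  An edge between these arcs keeps the remaining graph connected,
  and only the deletion of adjacent vertices can do that.
\<close>

lemma adj_if_linked:
  assumes d: "2 \<le> d" "d + 2 \<le> n"
    and kl: "i < k" "k < i + d" "i + d < l" "l < i + n" "c k \<rightarrow>\<^bsub>G\<^esub> c l"
  shows "c i \<rightarrow>\<^bsub>G\<^esub> c (i + d)"
proof (rule ccontr)
  assume "\<not> c i \<rightarrow>\<^bsub>G\<^esub> c (i + d)"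
  moreover have "c i \<noteq> c (i + d)"
    using inj_onD[OF inj_on_window[of i], of i "i + d"] d by auto
  ultimately have "\<not> conn_set (verts G - {c i, c (i + d)})"
    using nonadj_cut range_cycle by blast
  moreover have "conn_set (c ` {Suc i..<i + d} \<union> c ` {Suc (i + d)..<i + n})"
    by (rule conn_set_Un[of _ _ "c k" "c l"]) (use d kl conn_set_arc in auto)
  ultimately show False using verts_minus_2[of d i] d by simp
qed

text \<open>
  The chord itself links the two arcs left by deleting the successors of its ends.
\<close>

lemma chord_Suc:
  assumes d: "2 \<le> d" "d + 2 \<le> n" and "c i \<rightarrow>\<^bsub>G\<^esub> c (i + d)"
  shows "c (Suc i) \<rightarrow>\<^bsub>G\<^esub> c (Suc i + d)"
proof (rule adj_if_linked[OF d])
  show "c (i + d) \<rightarrow>\<^bsub>G\<^esub> c (i + n)"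
    using adj_sym[OF assms(3)] cycle_periodic by simp
qed (use d in auto)

lemma chord_everywhere:
  assumes d: "2 \<le> d" "d + 2 \<le> n" and "c i \<rightarrow>\<^bsub>G\<^esub> c (i + d)"
  shows "c j \<rightarrow>\<^bsub>G\<^esub> c (j + d)"
proof -
  have later: "c k \<rightarrow>\<^bsub>G\<^esub> c (k + d)" if "i \<le> k" for k
    using that
  proof (induction rule: dec_induct)
    case (step k)
    then show ?case using chord_Suc[OF d] by blast
  qed (rule assms)
  \<comment> \<open>The chord has been moved forward only; adding a multiple of \<open>n\<close> reaches the smaller indices.\<close>
  have "i \<le> n * i" using length_ge_3 by simp
  then have "c (j + n * i) \<rightarrow>\<^bsub>G\<^esub> c (j + n * i + d)"
    by (intro later trans_le_add2)
  moreover have "j + n * i + d = j + d + n * i" by simp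
  ultimately show ?thesis by (simp only: cycle_periodic)
qed

text \<open>
  Deleting \<open>c i\<close> and \<open>c (i + Suc d)\<close> leaves the arcs \<open>i + 1, ..., i + d\<close> and \<open>i + d + 2, ..., i + n - 1\<close>, which
  are linked by the rotated chord from \<open>c (i + 2)\<close> to \<open>c (i + 2 + d)\<close>.
\<close>

lemma chord_longer:
  assumes d: "2 \<le> d" "d + 3 \<le> n" and "c i \<rightarrow>\<^bsub>G\<^esub> c (i + d)"
  shows "c i \<rightarrow>\<^bsub>G\<^esub> c (i + Suc d)"
proof (rule adj_if_linked)
  show "c (i + 2) \<rightarrow>\<^bsub>G\<^esub> c (i + 2 + d)"
    by (rule chord_everywhere[OF _ _ assms(3)]) (use d in auto)
qed (use d in auto)

lemma chord_complement:
  assumes d: "2 \<le> d" "d + 2 \<le> n" and "c i \<rightarrow>\<^bsub>G\<^esub> c (i + d)"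
  shows "c i \<rightarrow>\<^bsub>G\<^esub> c (i + (n - d))"
proof -
  have "c (i + (n - d)) \<rightarrow>\<^bsub>G\<^esub> c (i + (n - d) + d)"
    by (rule chord_everywhere[OF assms])
  moreover have "i + (n - d) + d = i + n" using d by simp
  ultimately show ?thesis using adj_sym by (simp add: cycle_periodic)
qed

text \<open>
  Lengthening a chord step by step reaches length \<open>n - 2\<close>, its complement has length \<open>2\<close>, and from there
  lengthening reaches every length.
\<close>

lemma all_chords:
  assumes "2 \<le> d" "d + 2 \<le> n" "c i \<rightarrow>\<^bsub>G\<^esub> c (i + d)"
    and "2 \<le> e" "e + 2 \<le> n"
  shows "c j \<rightarrow>\<^bsub>G\<^esub> c (j + e)"
proof -
  have longer: "c i \<rightarrow>\<^bsub>G\<^esub> c (i + b)"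
    if "2 \<le> a" "c i \<rightarrow>\<^bsub>G\<^esub> c (i + a)" "a \<le> b" "b + 2 \<le> n" for a b
    using that(3,4)
  proof (induction rule: dec_induct)
    case (step b)
    then show ?case using chord_longer[of b] that(1) by simp
  qed (rule that)
  have "c i \<rightarrow>\<^bsub>G\<^esub> c (i + (n - 2))"
    using longer[of d "n - 2"] assms by simp
  then have "c i \<rightarrow>\<^bsub>G\<^esub> c (i + (n - (n - 2)))"
    using chord_complement[of "n - 2" i] assms by simp
  then have "c i \<rightarrow>\<^bsub>G\<^esub> c (i + 2)" using assms by simp
  then have "c i \<rightarrow>\<^bsub>G\<^esub> c (i + e)" using longer[of 2 e] assms by simp
  then show ?thesis using chord_everywhere assms by blast
qed

lemma complete_or_cycle: "complete_graph G \<or> cycle_graph G"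
proof (cases "\<exists>d i. 2 \<le> d \<and> d + 2 \<le> n \<and> c i \<rightarrow>\<^bsub>G\<^esub> c (i + d)")
  case True
  have "u \<rightarrow>\<^bsub>G\<^esub> v" if uv: "u \<in> verts G" "v \<in> verts G" "u \<noteq> v" for u v
  proof -
    obtain i where i: "u = c i" using uv range_cycle by blast
    obtain e where e: "0 < e" "e < n" "v = c (i + e)"
      using vertex_offset'[OF uv(2), of i] uv i by blast
    consider "e = 1" | "e = n - 1" | "2 \<le> e" "e + 2 \<le> n" using e by linarith
    then show ?thesis
    proof cases
      case 3
      then show ?thesis using True all_chords i e by blast
    qed (use i e offset_adj_1 in auto)
  qed
  then have "arcs_ends G = {(u, v). (u, v) \<in> verts G \<times> verts G \<and> u \<noteq> v}"
    using adj_in_verts adj_neq by blast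
  then show ?thesis unfolding complete_digraph_def using graph_axioms by blast
next
  case False
  have "arcs_ends G = (\<Union>i<n. {(c i, c (Suc i mod n)), (c (Suc i mod n), c i)})" (is "_ = ?R")
  proof (intro equalityI subrelI)
    fix u v assume uv: "u \<rightarrow>\<^bsub>G\<^esub> v"
    obtain i where i: "u = c (0 + i)" "i < n" using adj_in_verts(1)[OF uv] vertex_offset by blast
    obtain e where e: "0 < e" "e < n" "v = c (i + e)"
      using vertex_offset'[OF adj_in_verts(2)[OF uv], of i] adj_neq[OF uv] i by auto
    have "e = 1 \<or> e = n - 1"
    proof (rule ccontr)
      assume "\<not> (e = 1 \<or> e = n - 1)"
      then have "2 \<le> e" "e + 2 \<le> n" using e by linarith+
      then show False using False uv i e by auto
    qed
    then show "(u, v) \<in> ?R"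
    proof
      assume "e = 1"
      then have "v = c (Suc i mod n)" using e by (simp add: cycle_eq_iff)
      then show ?thesis using i by auto
    next
      \<comment> \<open>Then \<open>v\<close> is the predecessor of \<open>u\<close> on the cycle.\<close>
      assume [simp]: "e = n - 1"
      obtain j where j: "v = c (0 + j)" "j < n" using adj_in_verts(2)[OF uv] vertex_offset by blast
      have "c (Suc j) = c (Suc (i + e))" by (rule cycle_shift) (use j e in simp)
      also have "\<dots> = c i" using length_ge_3 cycle_periodic by simp
      finally have "u = c (Suc j mod n)" using i by (simp add: cycle_eq_iff)
      then show ?thesis using j by auto
    qed
  next
    fix u v assume "(u, v) \<in> ?R"
    moreover have "c (Suc i mod n) = c (Suc i)" for i by (simp add: cycle_eq_iff)
    ultimately obtain i where "u = c i \<and> v = c (Suc i) \<or> v = c i \<and> u = c (Suc i)" by auto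
    then show "u \<rightarrow>\<^bsub>G\<^esub> v" using cycle_adj adj_sym by blast
  qed
  moreover have "bij_betw c {..<n} (verts G)"
    using inj_on_window[of 0] window_eq[of 0] by (simp add: bij_betw_def lessThan_atLeast0)
  ultimately show ?thesis
    unfolding cycle_graph_def card_verts_cycle using graph_axioms length_ge_3 by blast
qed

end

section \<open>Closing up a longest path\<close>

context graph
begin

text \<open>
  Vertices outside a longest path are not adjacent to its ends.  So if the ends are deleted,
  everything outside the path remains attached to the interior of the path, which is connected; hence the
  deletion of the ends does not disconnect.
\<close>

lemma longest_path_ends_adj:
  assumes conn: "conn_set (verts G)"
    and path: "distinct p" "set p \<subseteq> verts G" "successively (\<lambda>u v. u \<rightarrow>\<^bsub>G\<^esub> v) p" "p \<noteq> []"
    and longest: "\<And>q. distinct q \<Longrightarrow> set q \<subseteq> verts G \<Longrightarrow> successively (\<lambda>u v. u \<rightarrow>\<^bsub>G\<^esub> v) q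
      \<Longrightarrow> length q \<le> length p"
    and cut: "\<And>u v. u \<in> verts G \<Longrightarrow> v \<in> verts G \<Longrightarrow> u \<noteq> v \<Longrightarrow> \<not> u \<rightarrow>\<^bsub>G\<^esub> v
      \<Longrightarrow> \<not> conn_set (verts G - {u, v})"
    and ends: "hd p \<noteq> last p"
  shows "last p \<rightarrow>\<^bsub>G\<^esub> hd p"
proof (rule ccontr)
  assume "\<not> last p \<rightarrow>\<^bsub>G\<^esub> hd p"
  then have nadj: "\<not> hd p \<rightarrow>\<^bsub>G\<^esub> last p" using adj_sym by blast
  have not_hd: "z \<in> set p" if "z \<rightarrow>\<^bsub>G\<^esub> hd p" for z
  proof (rule ccontr)
    assume "z \<notin> set p"
    then show False
      using longest[of "z # p"] path that adj_in_verts(1)[OF that] by (simp add: successively_Cons)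
  qed
  have not_last: "z \<in> set p" if "z \<rightarrow>\<^bsub>G\<^esub> last p" for z
  proof (rule ccontr)
    assume "z \<notin> set p"
    then show False
      using longest[of "p @ [z]"] path adj_sym[OF that] adj_in_verts(1)[OF that]
      by (simp add: successively_append_iff)
  qed
  obtain a r where r: "p = a # r" using path(4) by (cases p) auto
  then have "r \<noteq> []" using ends by auto
  then obtain q b where "r = q @ [b]" by (cases r rule: rev_cases) auto
  with r have p: "p = a # q @ [b]" by simp
  \<comment> \<open>Otherwise the path would be a single edge, with adjacent ends.\<close>
  have q: "q \<noteq> []" using path(3) nadj p by auto
  have "successively (\<lambda>u v. u \<rightarrow>\<^bsub>G\<^esub> v) q"
    using path(3) by (auto simp: p successively_Cons successively_append_iff)
  then have "conn_set (set q)" using q by (rule conn_set_path)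
  moreover have "set q \<subseteq> verts G - {a, b}" using path p by auto
  ultimately have "conn_set (verts G - {a, b})"
  proof (rule conn_set_extend)
    fix B assume B: "B \<subseteq> verts G - {a, b} - set q" "B \<noteq> {}"
    then have "B \<noteq> verts G" using path p by auto
    then obtain x y where xy: "x \<in> B" "y \<in> verts G - B" "x \<rightarrow>\<^bsub>G\<^esub> y"
      using conn_setD[OF conn, of B] B by blast
    then have "x \<notin> set p" using B p by auto
    then have "y \<noteq> a" "y \<noteq> b" using not_hd[of x] not_last[of x] xy p by auto
    then show "\<exists>x\<in>B. \<exists>y\<in>verts G - {a, b} - B. x \<rightarrow>\<^bsub>G\<^esub> y" using xy by blast
  qed
  then show False using cut[of a b] nadj ends path p by auto
qed

text \<open>
  If the path closes up, it can be cut open at any vertex \<open>y\<close>; a neighbour \<open>z\<close> of \<open>y\<close> outside the path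
  then extends it.  The hypothesis on the ends is conditional so that one-vertex paths are covered.
\<close>

lemma longest_closed_path_spanning:
  assumes conn: "conn_set (verts G)"
    and path: "distinct p" "set p \<subseteq> verts G" "successively (\<lambda>u v. u \<rightarrow>\<^bsub>G\<^esub> v) p" "p \<noteq> []"
    and longest: "\<And>q. distinct q \<Longrightarrow> set q \<subseteq> verts G \<Longrightarrow> successively (\<lambda>u v. u \<rightarrow>\<^bsub>G\<^esub> v) q
      \<Longrightarrow> length q \<le> length p"
    and ends: "hd p \<noteq> last p \<Longrightarrow> last p \<rightarrow>\<^bsub>G\<^esub> hd p"
  shows "set p = verts G"
proof (rule ccontr)
  assume "set p \<noteq> verts G"
  then obtain y z where yz: "y \<in> set p" "z \<in> verts G - set p" "y \<rightarrow>\<^bsub>G\<^esub> z"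
    using conn_setD[OF conn path(2)] path(4) by auto
  then obtain xs ys where p: "p = xs @ y # ys" by (meson split_list)
  let ?q = "z # (y # ys) @ xs"
  have "last p \<rightarrow>\<^bsub>G\<^esub> hd xs" if "xs \<noteq> []"
  proof -
    have "hd p = hd xs" "last p \<in> set (y # ys)" using that p by auto
    then have "hd p \<noteq> last p" using path(1) hd_in_set[OF that] p by auto
    then show ?thesis using ends \<open>hd p = hd xs\<close> by simp
  qed
  then have "successively (\<lambda>u v. u \<rightarrow>\<^bsub>G\<^esub> v) ?q"
    using path(3) adj_sym[OF yz(3)] p
    by (cases "xs = []"; cases "ys = []") (auto simp: successively_Cons successively_append_iff)
  moreover have "distinct ?q" "set ?q \<subseteq> verts G" "length ?q = Suc (length p)"
    using path yz p by auto
  ultimately show False using longest[of ?q] by simp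
qed

lemma hamiltonian_cycle_if_nonadj_cut:
  assumes conn: "conn_set (verts G)" and size: "3 \<le> card (verts G)"
    and cut: "\<And>u v. u \<in> verts G \<Longrightarrow> v \<in> verts G \<Longrightarrow> u \<noteq> v \<Longrightarrow> \<not> u \<rightarrow>\<^bsub>G\<^esub> v
      \<Longrightarrow> \<not> conn_set (verts G - {u, v})"
  obtains c where "hamiltonian_cycle G c (card (verts G))"
proof -
  let ?P = "\<lambda>p. distinct p \<and> set p \<subseteq> verts G \<and> successively (\<lambda>u v. u \<rightarrow>\<^bsub>G\<^esub> v) p"
  have bound: "length p \<le> card (verts G)" if "?P p" for p
    using that card_mono[OF finite_verts, of "set p"] by (simp add: distinct_card)
  obtain p where p: "?P p" and longest: "\<And>q. ?P q \<Longrightarrow> length q \<le> length p"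
    using ex_has_greatest_nat[of ?P "[]" length "Suc (card (verts G))"] bound
    by (auto simp: less_Suc_eq_le)
  obtain v where "v \<in> verts G" using size by fastforce
  then have "p \<noteq> []" using longest[of "[v]"] by auto
  have ends: "last p \<rightarrow>\<^bsub>G\<^esub> hd p" if "hd p \<noteq> last p"
    using longest_path_ends_adj[OF conn _ _ _ \<open>p \<noteq> []\<close> _ cut that] p longest by blast
  have "set p = verts G"
    using longest_closed_path_spanning[OF conn _ _ _ \<open>p \<noteq> []\<close> _ ends] p longest by blast
  then have len: "length p = card (verts G)" using p distinct_card by force
  let ?n = "card (verts G)"
  have n: "0 < ?n" using size by linarith
  have "hd p \<noteq> last p"
    using p len size \<open>p \<noteq> []\<close> by (simp add: hd_conv_nth last_conv_nth nth_eq_iff_index_eq)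
  have "hamiltonian_cycle G (\<lambda>k. p ! (k mod ?n)) ?n"
  proof (unfold_locales)
    fix i j
    show "p ! (i mod ?n) = p ! (j mod ?n) \<longleftrightarrow> i mod ?n = j mod ?n"
      using p len n by (simp add: nth_eq_iff_index_eq)
    show "p ! (i mod ?n) \<rightarrow>\<^bsub>G\<^esub> p ! (Suc i mod ?n)"
    proof (cases "Suc (i mod ?n) = ?n")
      case True
      then have "i mod ?n = ?n - 1" "Suc i mod ?n = 0" by (simp_all add: mod_Suc)
      then have "p ! (i mod ?n) = last p" "Suc i mod ?n = 0"
        using \<open>p \<noteq> []\<close> len by (simp_all add: last_conv_nth)
      then show ?thesis using ends \<open>hd p \<noteq> last p\<close> \<open>p \<noteq> []\<close> by (simp add: hd_conv_nth)
    next
      case False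
      then have "Suc (i mod ?n) < length p" using n len by (simp add: Suc_lessI)
      then have "p ! (i mod ?n) \<rightarrow>\<^bsub>G\<^esub> p ! Suc (i mod ?n)"
        using p successively_nth[of "\<lambda>u v. u \<rightarrow>\<^bsub>G\<^esub> v" p "i mod ?n"] by blast
      then show ?thesis using False by (simp add: mod_Suc)
    qed
  next
    have "range (\<lambda>k. p ! (k mod ?n)) \<subseteq> set p" using n len by auto
    moreover have "v \<in> range (\<lambda>k. p ! (k mod ?n))" if v: "v \<in> set p" for v
    proof -
      obtain k where "k < ?n" "v = p ! k" using v len by (auto simp: in_set_conv_nth)
      then have "v = p ! (k mod ?n)" by simp
      then show ?thesis by (rule range_eqI)
    qed
    ultimately show "range (\<lambda>k. p ! (k mod ?n)) = verts G"
      using \<open>set p = verts G\<close> by (intro equalityI subsetI) auto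
    show "3 \<le> ?n" by (rule size)
  qed
  then show ?thesis by (rule that)
qed

lemma complete_or_cycle_if_nonadj_cut:
  assumes "conn_set (verts G)" "3 \<le> card (verts G)"
    and cut: "\<And>u v. u \<in> verts G \<Longrightarrow> v \<in> verts G \<Longrightarrow> u \<noteq> v \<Longrightarrow> \<not> u \<rightarrow>\<^bsub>G\<^esub> v
      \<Longrightarrow> \<not> conn_set (verts G - {u, v})"
  shows "complete_graph G \<or> cycle_graph G"
proof -
  obtain c where "hamiltonian_cycle G c (card (verts G))"
    using hamiltonian_cycle_if_nonadj_cut[OF assms] .
  then interpret hamiltonian_cycle G c "card (verts G)" .
  interpret hamiltonian_cycle_with_cuts G c "card (verts G)"
    by unfold_locales (rule cut)
  show ?thesis by (rule complete_or_cycle)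
qed

end

section \<open>Cycles\<close>

context graph
begin

lemma finite_components: "X \<subseteq> verts G \<Longrightarrow> finite (components (G \<restriction> X))"
  using Union_components finite_UnionD finite_subset[OF _ finite_verts] by metis

lemma edges_between_empty_iff: "edges_between G A B = {} \<longleftrightarrow> no_edge A B"
  unfolding edges_between_def no_edge_def by (auto simp: arcs_ends_conv)

lemma safe_set_le:
  assumes "weighted_safe_set G w S" "C \<in> components (G \<restriction> S)"
    and "D \<in> components (G \<restriction> (verts G - S))" "x \<in> C" "y \<in> D" "x \<rightarrow>\<^bsub>G\<^esub> y"
  shows "sum w D \<le> sum w C"
proof -
  have "edges_between G C D \<noteq> {}"
    using assms(4-6) unfolding edges_between_empty_iff no_edge_def by blast
  then show ?thesis using assms(1-3) unfolding weighted_safe_set_def by blast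
qed

end

locale chordless_cycle = hamiltonian_cycle +
  assumes chordless: "u \<rightarrow>\<^bsub>G\<^esub> v \<Longrightarrow> \<exists>i. u = c i \<and> v = c (Suc i) \<or> v = c i \<and> u = c (Suc i)"
begin

text \<open>
  In the window from \<open>i\<close> to \<open>i + n - 1\<close>, edges join only consecutive indices, except for the edge between the
  first and the last index; and the first one is \<open>i\<close>, which belongs to neither arc.
\<close>

lemma arcs_separated:
  assumes "0 < d" "d < n"
  shows "no_edge (c ` {Suc i..<i + d}) (c ` {Suc (i + d)..<i + n})"
proof -
  have step: "b = Suc a"
    if ab: "a \<in> {Suc i..<i + n}" "b \<in> {Suc i..<i + n}" and "c a = c j" "c b = c (Suc j)" for a b j
  proof -
    have eq: "c b = c (Suc a)" using cycle_shift[of a j] that by simp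
    have "Suc a \<noteq> i + n"
    proof
      assume "Suc a = i + n"
      then have "c b = c i" using eq cycle_periodic(1)[of i] by simp
      then show False using inj_onD[OF inj_on_window[of i], of b i] ab by auto
    qed
    then show ?thesis using inj_onD[OF inj_on_window[of i] eq] ab by auto
  qed
  show ?thesis
    unfolding no_edge_def
  proof (intro ballI notI)
    fix x y assume "x \<in> c ` {Suc i..<i + d}" "y \<in> c ` {Suc (i + d)..<i + n}" and xy: "x \<rightarrow>\<^bsub>G\<^esub> y"
    then obtain k l where kl: "k \<in> {Suc i..<i + d}" "x = c k" "l \<in> {Suc (i + d)..<i + n}" "y = c l"
      by blast
    obtain j where "c k = c j \<and> c l = c (Suc j) \<or> c l = c j \<and> c k = c (Suc j)"
      using chordless[OF xy] kl by auto
    then have "l = Suc k \<or> k = Suc l"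
      using step[of k l j] step[of l k j] kl assms by auto
    then show False using kl by auto
  qed
qed

lemma arcs_disjoint: "c ` {Suc i..<i + d} \<inter> c ` {Suc (i + d)..<i + n} = {}"
proof (cases "d < n")
  case True
  have "c ` ({Suc i..<i + d} \<inter> {Suc (i + d)..<i + n})
      = c ` {Suc i..<i + d} \<inter> c ` {Suc (i + d)..<i + n}"
    by (rule inj_on_image_Int[OF inj_on_window[of i]]) (use True in auto)
  then show ?thesis by auto
qed simp

lemma conn_set_in_one_arc:
  assumes "conn_set X" "X \<subseteq> verts G - {c i, c (i + d)}" "0 < d" "d < n"
  shows "X \<inter> c ` {Suc i..<i + d} = {} \<or> X \<inter> c ` {Suc (i + d)..<i + n} = {}"
proof -
  have "X \<subseteq> c ` {Suc i..<i + d} \<or> X \<subseteq> c ` {Suc (i + d)..<i + n}"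
    using conn_set_one_side[OF assms(1) _ arcs_separated] assms verts_minus_2 by simp
  then show ?thesis using arcs_disjoint[of i d] by blast
qed

lemma nonadj_cut:
  assumes uv: "u \<in> verts G" "v \<in> verts G" "u \<noteq> v" "\<not> u \<rightarrow>\<^bsub>G\<^esub> v"
  shows "\<not> conn_set (verts G - {u, v})"
proof
  assume conn: "conn_set (verts G - {u, v})"
  obtain i where i: "u = c i" using uv range_cycle by blast
  obtain d where d: "0 < d" "d < n" "v = c (i + d)"
    using vertex_offset'[OF uv(2), of i] uv i by blast
  have "d \<noteq> 1" "d \<noteq> n - 1" using offset_adj_1[of i] uv(4) i d(3) by auto
  then have "Suc i \<in> {Suc i..<i + d}" "Suc (i + d) \<in> {Suc (i + d)..<i + n}"
    using d by auto
  then show False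
    using conn_set_in_one_arc[OF conn, of i d] d i verts_minus_2[OF d(1,2), of i] by blast
qed

lemma conn_set_verts_minus_vertex:
  assumes "v \<in> verts G" shows "conn_set (verts G - {v})"
proof -
  obtain i where "v = c i" using assms range_cycle by blast
  then show ?thesis using conn_set_arc[of "Suc i" "i + n"] length_ge_3 verts_minus_1[of i] by simp
qed

lemma conn_set_verts_minus_edge:
  assumes "u \<rightarrow>\<^bsub>G\<^esub> v" shows "conn_set (verts G - {u, v})"
proof -
  have "conn_set (verts G - {c i, c (Suc i)})" for i
    using conn_set_arc[of "Suc (Suc i)" "i + n"] length_ge_3 verts_minus_2[of 1 i] by simp
  then show ?thesis using chordless[OF assms] by (metis insert_commute)
qed

text \<open>
  A connected proper part of the cycle is an arc and has a single last vertex: were \<open>c i\<close> and \<open>c j\<close> both last, the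
  vertices after them would lie outside \<open>X\<close> and cut the cycle into two arcs that both meet \<open>X\<close>.
\<close>

lemma exit_unique:
  assumes conn: "conn_set X" and sub: "X \<subseteq> verts G"
    and i: "c i \<in> X" "c (Suc i) \<notin> X" and j: "c j \<in> X" "c (Suc j) \<notin> X"
  shows "c i = c j"
proof (rule ccontr)
  assume "c i \<noteq> c j"
  moreover have "c j \<in> verts G" using range_cycle by blast
  ultimately obtain d where d: "0 < d" "d < n" "c j = c (i + d)"
    using vertex_offset'[of "c j" i] by metis
  have "c (Suc j) = c (Suc i + d)" using cycle_shift[OF d(3)] by simp
  then have X: "X \<subseteq> verts G - {c (Suc i), c (Suc i + d)}" using i j sub by auto
  \<comment> \<open>The vertices \<open>c (Suc i)\<close> and \<open>c (Suc i + d)\<close> have \<open>c j = c (i + d)\<close> strictly between them on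
    one side, and \<open>c i = c (i + n)\<close> on the other.\<close>
  have "d \<noteq> 1" using d(3) j(1) i(2) by auto
  then have "i + d \<in> {Suc (Suc i)..<Suc i + d}" using d by auto
  moreover have "d \<noteq> n - 1"
  proof
    assume "d = n - 1"
    then have "c (Suc i + d) = c i" using cycle_periodic(1)[of i] length_ge_3 by simp
    then show False using X i by auto
  qed
  then have "i + n \<in> {Suc (Suc i + d)..<Suc i + n}" using d by auto
  moreover have "c (i + d) \<in> X" "c (i + n) \<in> X" using i j d cycle_periodic(1)[of i] by auto
  ultimately show False
    using conn_set_in_one_arc[OF conn X d(1,2)] by blast
qed

lemma entry_exists:
  assumes "D \<subseteq> verts G" "D \<noteq> {}" "D \<noteq> verts G"
  shows "\<exists>i. c i \<notin> D \<and> c (Suc i) \<in> D"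
proof (rule ccontr)
  assume contr: "\<not> ?thesis"
  obtain v where v: "v \<in> verts G" "v \<notin> D" using assms by blast
  obtain k where k: "v = c (0 + k)" using vertex_offset[OF v(1)] .
  have out: "c (k + m) \<notin> D" for m
    by (induction m) (use k v contr in auto)
  obtain w where w: "w \<in> D" using assms by blast
  then have "w \<in> verts G" using assms by blast
  then obtain m where "w = c (k + m)" using vertex_offset by blast
  then show False using out w by blast
qed

text \<open>
  Each component \<open>D\<close> of the complement is entered at some point along the cycle, from a component
  of \<open>G[S]\<close> that weighs at least as much as \<open>D\<close>.  A component of \<open>G[S]\<close> is left only once (\<open>exit_unique\<close>), so different \<open>D\<close> get
  different partners and summation gives the claim.
\<close>

lemma weighted_safe_set_half:
  assumes safe: "weighted_safe_set G w S" and w: "\<And>v. v \<in> verts G \<Longrightarrow> 0 \<le> w v"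
  shows "sum w (verts G - S) \<le> sum w S"
proof -
  let ?CS = "components (G \<restriction> S)" and ?DS = "components (G \<restriction> (verts G - S))"
  have S: "S \<noteq> {}" "S \<subseteq> verts G" using safe unfolding weighted_safe_set_def by auto
  have "\<exists>C. C \<in> ?CS \<and> (\<exists>i. c i \<in> C \<and> c (Suc i) \<in> D)" if "D \<in> ?DS" for D
  proof -
    have D: "D \<subseteq> verts G - S" "D \<noteq> {}" "no_edge D (verts G - S - D)"
      using that unfolding components_induce conn_set_def by auto
    then have "D \<subseteq> verts G" "D \<noteq> verts G" using S by auto
    then obtain i where i: "c i \<notin> D" "c (Suc i) \<in> D" using entry_exists D(2) by blast
    have "c i \<in> S"
    proof (rule ccontr)
      assume "c i \<notin> S"
      then have "c i \<in> verts G - S - D" using i range_cycle by auto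
      then show False using D(3) i(2) adj_sym[OF cycle_adj[of i]] unfolding no_edge_def by blast
    qed
    then obtain C where "c i \<in> C" "C \<in> ?CS" using in_component by blast
    then show ?thesis using i by blast
  qed
  then obtain f where f: "\<And>D. D \<in> ?DS \<Longrightarrow> f D \<in> ?CS \<and> (\<exists>i. c i \<in> f D \<and> c (Suc i) \<in> D)"
    by metis
  have inj: "inj_on f ?DS"
  proof (rule inj_onI, rule ccontr)
    fix D E assume DE: "D \<in> ?DS" "E \<in> ?DS" "f D = f E" "D \<noteq> E"
    obtain i j where i: "c i \<in> f D" "c (Suc i) \<in> D" and j: "c j \<in> f E" "c (Suc j) \<in> E"
      using f DE by blast
    have fD: "conn_set (f D)" "f D \<subseteq> S"
      using f[OF DE(1)] unfolding components_induce by blast+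
    have "D \<subseteq> verts G - S" "E \<subseteq> verts G - S" using DE unfolding components_induce by blast+
    then have "c (Suc i) \<notin> f D" "c (Suc j) \<notin> f D" using i j fD(2) by blast+
    then have "c i = c j"
      using exit_unique[OF fD(1), of i j] i j DE(3) fD(2) S(2) by auto
    then have "c (Suc i) = c (Suc j)" by (rule cycle_shift)
    then show False using components_disjoint[OF DE(1,2,4)] i j by auto
  qed
  have "sum w (verts G - S) = (\<Sum>D\<in>?DS. sum w D)"
    by (rule sum_components) blast
  also have "\<dots> \<le> (\<Sum>D\<in>?DS. sum w (f D))"
  proof (rule sum_mono)
    fix D assume D: "D \<in> ?DS"
    then obtain i where "c i \<in> f D" "c (Suc i) \<in> D" using f by blast
    then show "sum w D \<le> sum w (f D)"
      using safe_set_le[OF safe _ D] f[OF D] cycle_adj[of i] by blast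
  qed
  also have "\<dots> = (\<Sum>C\<in>f ` ?DS. sum w C)"
    using sum.reindex[OF inj, of "sum w"] by simp
  also have "\<dots> \<le> (\<Sum>C\<in>?CS. sum w C)"
  proof (rule sum_mono2)
    show "finite ?CS" using S(2) by (rule finite_components)
    show "f ` ?DS \<subseteq> ?CS" using f by blast
    fix C assume "C \<in> ?CS - f ` ?DS"
    then have "C \<subseteq> verts G" using S(2) unfolding components_induce by blast
    then show "0 \<le> sum w C" using w by (intro sum_nonneg) blast
  qed
  also have "\<dots> = sum w S" by (rule sum_components[OF S(2), symmetric])
  finally show ?thesis .
qed

end

context graph
begin

lemma chordless_cycle_if_cycle_graph:
  assumes "cycle_graph G"
  obtains c where "chordless_cycle G c (card (verts G))"
proof -
  let ?n = "card (verts G)"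
  obtain c where bij: "bij_betw c {..<?n} (verts G)"
    and ends: "arcs_ends G = (\<Union>i<?n. {(c i, c (Suc i mod ?n)), (c (Suc i mod ?n), c i)})"
    and size: "3 \<le> ?n"
    using assms unfolding cycle_graph_def by blast
  have n: "0 < ?n" using size by linarith
  have "chordless_cycle G (\<lambda>k. c (k mod ?n)) ?n"
  proof (unfold_locales)
    fix i j
    show "c (i mod ?n) = c (j mod ?n) \<longleftrightarrow> i mod ?n = j mod ?n"
      using inj_on_eq_iff[OF bij_betw_imp_inj_on[OF bij], of "i mod ?n" "j mod ?n"] n by simp
    have "(c (i mod ?n), c (Suc (i mod ?n) mod ?n)) \<in> arcs_ends G"
      unfolding ends using n by auto
    then show "c (i mod ?n) \<rightarrow>\<^bsub>G\<^esub> c (Suc i mod ?n)" by (simp add: mod_Suc_eq)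
  next
    have "{..<?n} \<subseteq> range (\<lambda>k. k mod ?n)"
    proof
      fix k assume "k \<in> {..<?n}"
      then have "k = k mod ?n" by simp
      then show "k \<in> range (\<lambda>k. k mod ?n)" by (rule range_eqI)
    qed
    then have "range (\<lambda>k. k mod ?n) = {..<?n}" using n by auto
    then have "range (\<lambda>k. c (k mod ?n)) = c ` {..<?n}" using image_image[of c "\<lambda>k. k mod ?n" UNIV] by simp
    then show "range (\<lambda>k. c (k mod ?n)) = verts G" using bij by (simp add: bij_betw_def)
    show "3 \<le> ?n" by (rule size)
  next
    fix u v assume "u \<rightarrow>\<^bsub>G\<^esub> v"
    then obtain i where "i < ?n" "u = c i \<and> v = c (Suc i mod ?n) \<or> v = c i \<and> u = c (Suc i mod ?n)"
      unfolding ends by blast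
    then show "\<exists>i. u = c (i mod ?n) \<and> v = c (Suc i mod ?n) \<or> v = c (i mod ?n) \<and> u = c (Suc i mod ?n)"
      by (metis mod_less)
  qed
  then show ?thesis by (rule that)
qed

end

section \<open>Separating edges and nonseparating nonedges\<close>

text \<open>
  Remove an index whose set is not covered by the others, and repeat; each removal loses an element of
  the union.
\<close>

lemma card_le_card_UN_if_private_elements:
  assumes "finite F" "\<And>e. e \<in> F \<Longrightarrow> finite (A e)"
    and "\<And>F'. F' \<subseteq> F \<Longrightarrow> F' \<noteq> {} \<Longrightarrow> \<exists>e\<in>F'. \<not> A e \<subseteq> \<Union>(A ` (F' - {e}))"
  shows "card F \<le> card (\<Union>(A ` F))"
  using assms
proof (induction F rule: finite_psubset_induct)
  case (psubset F)
  show ?case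
  proof (cases "F = {}")
    case False
    then obtain e where e: "e \<in> F" "\<not> A e \<subseteq> \<Union>(A ` (F - {e}))"
      using psubset.prems(2)[of F] by blast
    have "card (F - {e}) \<le> card (\<Union>(A ` (F - {e})))"
    proof (rule psubset.IH)
      fix F' assume F': "F' \<subseteq> F - {e}" "F' \<noteq> {}"
      then have "F' \<subseteq> F" by blast
      then show "\<exists>e\<in>F'. \<not> A e \<subseteq> \<Union>(A ` (F' - {e}))" using psubset.prems(2) F'(2) by simp
    qed (use e psubset.prems(1) in auto)
    moreover have "card (\<Union>(A ` (F - {e}))) < card (\<Union>(A ` F))"
      by (rule psubset_card_mono) (use e psubset.hyps psubset.prems(1) in auto)
    moreover have "card F = Suc (card (F - {e}))"
      using card_Suc_Diff1[OF psubset.hyps e(1)] by simp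
    ultimately show ?thesis by linarith
  qed simp
qed

context graph
begin

definition separating_edges :: "'a set set" where
  "separating_edges = {{u, v} | u v. u \<rightarrow>\<^bsub>G\<^esub> v \<and> \<not> conn_set (verts G - {u, v})}"

definition nonseparating_nonedges :: "'a set set" where
  "nonseparating_nonedges = {{x, y} | x y. x \<in> verts G \<and> y \<in> verts G \<and> x \<noteq> y \<and> \<not> x \<rightarrow>\<^bsub>G\<^esub> y
     \<and> conn_set (verts G - {x, y})}"

text \<open>
  A side is any union of some but not all components that remain after deleting \<open>e\<close>.  It need not
  be connected, so the complement of a side is again a side, and a side can be chosen to avoid a given vertex.
\<close>

definition cut_side :: "'a set \<Rightarrow> 'a set \<Rightarrow> bool" where
  "cut_side e A \<longleftrightarrow> A \<subseteq> verts G - e \<and> A \<noteq> {} \<and> verts G - e - A \<noteq> {} \<and> no_edge A (verts G - e - A)"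

lemma cut_side_compl: "cut_side e A \<Longrightarrow> cut_side e (verts G - e - A)"
proof -
  assume A: "cut_side e A"
  then have "verts G - e - (verts G - e - A) = A" unfolding cut_side_def by blast
  then show ?thesis using A no_edge_sym unfolding cut_side_def by auto
qed

lemma cut_side_avoiding:
  assumes "\<not> conn_set (verts G - e)" "\<not> verts G \<subseteq> e"
  obtains A where "cut_side e A" "r \<notin> A"
proof -
  obtain A where A: "cut_side e A"
    using assms unfolding conn_set_def cut_side_def by blast
  then show ?thesis using that cut_side_compl[OF A] by blast
qed

lemma separating_edges_finite: "finite separating_edges"
proof (rule finite_subset)
  show "separating_edges \<subseteq> Pow (verts G)"
    unfolding separating_edges_def using adj_in_verts by blast
qed simp

lemma nonseparating_nonedges_finite: "finite nonseparating_nonedges"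
proof (rule finite_subset)
  show "nonseparating_nonedges \<subseteq> Pow (verts G)"
    unfolding nonseparating_nonedges_def by blast
qed simp

lemma separating_edgeE:
  assumes "e \<in> separating_edges" "s \<in> e"
  obtains t where "e = {s, t}" "s \<noteq> t" "s \<in> verts G" "t \<in> verts G" "s \<rightarrow>\<^bsub>G\<^esub> t"
    "\<not> conn_set (verts G - e)"
proof -
  obtain u v where uv: "e = {u, v}" "u \<rightarrow>\<^bsub>G\<^esub> v" "\<not> conn_set (verts G - e)"
    using assms(1) unfolding separating_edges_def by blast
  consider "s = u" | "s = v" using assms(2) uv(1) by blast
  then show ?thesis
  proof cases
    case 1
    show ?thesis
      by (rule that[of v]) (use uv 1 adj_in_verts[OF uv(2)] adj_neq[OF uv(2)] in auto)
  next
    case 2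
    show ?thesis
      by (rule that[of u])
        (use uv 2 adj_in_verts[OF uv(2)] adj_neq[OF uv(2)] adj_sym[OF uv(2)] in auto)
  qed
qed

lemma separating_edge_nonempty: "e \<in> separating_edges \<Longrightarrow> e \<noteq> {}"
  unfolding separating_edges_def by blast

lemma separating_edge_conn: "e \<in> separating_edges \<Longrightarrow> conn_set e"
  unfolding separating_edges_def using conn_set_pair adj_neq by blast

lemma separating_edge_subset: "e \<in> separating_edges \<Longrightarrow> e \<subseteq> verts G"
  unfolding separating_edges_def using adj_in_verts by blast

lemma card_separating_edge: "e \<in> separating_edges \<Longrightarrow> card e = 2"
  unfolding separating_edges_def using adj_neq by auto

lemma separating_edges_diff:
  assumes "e \<in> separating_edges" "f \<in> separating_edges" "e \<noteq> f"
  obtains s where "s \<in> e" "s \<notin> f"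
proof -
  have "\<not> e \<subseteq> f"
    using card_subset_eq[of f e] card_separating_edge assms card.infinite[of f] by fastforce
  then show ?thesis using that by blast
qed

end

locale no_cut_vertex = graph +
  assumes conn_minus_vertex: "v \<in> verts G \<Longrightarrow> conn_set (verts G - {v})"
    and size_ge_5: "5 \<le> card (verts G)"
begin

text \<open>
  Let \<open>t\<close> be the other end of \<open>e\<close>.  Since \<open>t\<close> is no cut vertex, from every part of the side an edge
  leads elsewhere without using \<open>t\<close>, and it cannot lead to the opposite side.  So the side is tied
  together by \<open>s\<close> alone.
\<close>

lemma conn_side_with_end:
  assumes e: "e \<in> separating_edges" "s \<in> e" and A: "cut_side e A"
  shows "conn_set (insert s A)"
proof -
  obtain t where t: "e = {s, t}" "s \<noteq> t" "s \<in> verts G" "t \<in> verts G"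
    using separating_edgeE[OF e] by blast
  show ?thesis
  proof (rule conn_set_extend[OF conn_set_singleton[of s]])
    fix B assume B: "B \<subseteq> insert s A - {s}" "B \<noteq> {}"
    have "B \<subseteq> verts G - {t}" "B \<noteq> verts G - {t}"
      using B A t unfolding cut_side_def by blast+
    then obtain b x where bx: "b \<in> B" "x \<in> verts G - {t} - B" "b \<rightarrow>\<^bsub>G\<^esub> x"
      using conn_setD[OF conn_minus_vertex[OF t(4)]] B(2) by metis
    moreover have "x \<in> insert s A"
      using bx A B t(1) unfolding cut_side_def no_edge_def by blast
    ultimately show "\<exists>b\<in>B. \<exists>x\<in>insert s A - B. b \<rightarrow>\<^bsub>G\<^esub> x" by blast
  qed simp
qed

text \<open>
  The vertex \<open>x\<close> is no cut vertex, so from every part of \<open>A - {x}\<close> an edge leads elsewhere, and within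
  \<open>A \<union> e\<close>; the ends of \<open>e\<close> are adjacent and so serve as a connected core.
\<close>

lemma conn_side_with_edge_minus_vertex:
  assumes e: "e \<in> separating_edges" and A: "cut_side e A" and x: "x \<in> A"
  shows "conn_set (A \<union> e - {x})"
proof (rule conn_set_extend[OF separating_edge_conn[OF e]])
  show "e \<subseteq> A \<union> e - {x}" using A x unfolding cut_side_def by blast
  fix B assume B: "B \<subseteq> A \<union> e - {x} - e" "B \<noteq> {}"
  have xV: "x \<in> verts G" using A x unfolding cut_side_def by blast
  have "B \<subseteq> verts G - {x}" "B \<noteq> verts G - {x}"
    using B A x separating_edge_nonempty[OF e] separating_edge_subset[OF e]
    unfolding cut_side_def by blast+
  then obtain b y where edge: "b \<in> B" "y \<in> verts G - {x} - B" "b \<rightarrow>\<^bsub>G\<^esub> y"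
    using conn_setD[OF conn_minus_vertex[OF xV]] B(2) by metis
  moreover have "y \<in> A \<union> e - {x}"
    using edge A B unfolding cut_side_def no_edge_def by blast
  ultimately show "\<exists>b\<in>B. \<exists>y\<in>A \<union> e - {x} - B. b \<rightarrow>\<^bsub>G\<^esub> y" by blast
qed

text \<open>
  After deletion of \<open>x\<close> and \<open>y\<close>, each of the two sides is still connected together with \<open>e\<close>, and the two share \<open>e\<close>.
\<close>

lemma crossing_pair:
  assumes e: "e \<in> separating_edges" and A: "cut_side e A"
    and x: "x \<in> A" and y: "y \<in> verts G - e - A"
  shows "{x, y} \<in> nonseparating_nonedges"
proof -
  let ?R = "verts G - e - A"
  obtain s where s: "s \<in> e" using separating_edge_nonempty[OF e] by blast
  have "conn_set ((A \<union> e - {x}) \<union> (?R \<union> e - {y}))"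
  proof (rule conn_set_Un[of _ _ s s])
    show "conn_set (A \<union> e - {x})" by (rule conn_side_with_edge_minus_vertex[OF e A x])
    show "conn_set (?R \<union> e - {y})"
      by (rule conn_side_with_edge_minus_vertex[OF e cut_side_compl[OF A] y])
    show "s \<in> A \<union> e - {x}" "s \<in> ?R \<union> e - {y}" "s = s \<or> s \<rightarrow>\<^bsub>G\<^esub> s"
      using s x y A unfolding cut_side_def by auto
  qed
  moreover have "(A \<union> e - {x}) \<union> (?R \<union> e - {y}) = verts G - {x, y}"
    using A x y separating_edge_subset[OF e] unfolding cut_side_def by auto
  ultimately have "conn_set (verts G - {x, y})" by simp
  moreover have "x \<in> verts G" "y \<in> verts G" "x \<noteq> y" "\<not> x \<rightarrow>\<^bsub>G\<^esub> y"
    using A x y unfolding cut_side_def no_edge_def by auto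
  ultimately show ?thesis unfolding nonseparating_nonedges_def by blast
qed

lemma separating_edge_in_side:
  assumes f: "f \<in> separating_edges" and A: "cut_side e A" and a: "a \<in> f" "a \<in> A"
  shows "f \<inter> (verts G - e - A) = {}"
proof -
  obtain b where b: "f = {a, b}" "a \<rightarrow>\<^bsub>G\<^esub> b" using separating_edgeE[OF f a(1)] .
  then show ?thesis using A a unfolding cut_side_def no_edge_def by blast
qed

text \<open>
  If \<open>f\<close> meets the side \<open>A\<close> of \<open>e\<close>, it does not meet the opposite side.  This opposite side, with an end of \<open>e\<close> that is not
  on \<open>f\<close>, is therefore connected after deletion of \<open>f\<close>, and lies together with \<open>r\<close> outside \<open>B\<close>.  Only the part
  of \<open>A\<close> off \<open>f\<close> is left for \<open>B\<close>.
\<close>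

lemma side_nested:
  assumes e: "e \<in> separating_edges" and A: "cut_side e A"
    and f: "f \<in> separating_edges" and B: "cut_side f B"
    and a: "a \<in> f" "a \<in> A" and r: "r \<in> verts G - e - A" "r \<notin> B"
  shows "B \<subseteq> A - {a}"
proof -
  let ?R = "verts G - e - A"
  have fR: "f \<inter> ?R = {}" by (rule separating_edge_in_side[OF f A a])
  have "insert s ?R \<inter> B = {}" if s: "s \<in> e" "s \<notin> f" for s
  proof -
    have "insert s ?R \<subseteq> B \<or> insert s ?R \<subseteq> verts G - f - B"
    proof (rule conn_set_one_side)
      show "conn_set (insert s ?R)" by (rule conn_side_with_end[OF e s(1) cut_side_compl[OF A]])
      show "no_edge B (verts G - f - B)" using B unfolding cut_side_def by blast
      show "insert s ?R \<subseteq> B \<union> (verts G - f - B)"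
        using fR s separating_edge_subset[OF e] by blast
    qed
    then show ?thesis using r by blast
  qed
  moreover have "e \<noteq> f" using a A unfolding cut_side_def by blast
  then obtain s where "s \<in> e" "s \<notin> f" using separating_edges_diff[OF e f] by blast
  ultimately show ?thesis using B a unfolding cut_side_def by blast
qed

text \<open>
  If \<open>f\<close> misses \<open>A\<close>, then \<open>A\<close> with an end of \<open>e\<close> that is not on \<open>f\<close> is connected after deletion of \<open>f\<close>, so
  it lies entirely inside or entirely outside \<open>B\<close>.
\<close>

lemma side_disjoint_or_inside:
  assumes e: "e \<in> separating_edges" and A: "cut_side e A"
    and f: "f \<in> separating_edges" and B: "cut_side f B"
    and "e \<noteq> f" and fA: "f \<inter> A = {}"
  shows "A \<subset> B \<or> A \<inter> B = {}"
proof -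
  obtain s where s: "s \<in> e" "s \<notin> f" using separating_edges_diff[OF e f \<open>e \<noteq> f\<close>] .
  have "insert s A \<subseteq> B \<or> insert s A \<subseteq> verts G - f - B"
  proof (rule conn_set_one_side)
    show "conn_set (insert s A)" by (rule conn_side_with_end[OF e s(1) A])
    show "no_edge B (verts G - f - B)" using B unfolding cut_side_def by blast
    show "insert s A \<subseteq> B \<union> (verts G - f - B)"
      using fA s A separating_edge_subset[OF e] unfolding cut_side_def by blast
  qed
  moreover have "s \<notin> A" using s A unfolding cut_side_def by blast
  ultimately show ?thesis by blast
qed

lemma ex_cut_side:
  assumes "e \<in> separating_edges"
  obtains A where "cut_side e A" "r \<notin> A"
proof -
  obtain s where s: "s \<in> e" using separating_edge_nonempty[OF assms] by blast
  have "\<not> verts G \<subseteq> e"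
  proof
    assume "verts G \<subseteq> e"
    moreover have "finite e" using card_separating_edge[OF assms] by (intro card_ge_0_finite) simp
    ultimately have "card (verts G) \<le> card e" by (intro card_mono)
    then show False using card_separating_edge[OF assms] size_ge_5 by simp
  qed
  moreover have "\<not> conn_set (verts G - e)" using separating_edgeE[OF assms s] .
  ultimately show ?thesis using cut_side_avoiding that by blast
qed

text \<open>
  Any vertex \<open>r\<close> of a smallest side will do: a separating edge through \<open>r\<close> would have a side strictly
  inside the smallest one (\<open>side_nested\<close>).
\<close>

lemma vertex_off_separating_edges:
  assumes "separating_edges \<noteq> {}"
  obtains r where "r \<in> verts G" "r \<notin> \<Union>separating_edges"
proof -
  let ?P = "\<lambda>(e, A). e \<in> separating_edges \<and> cut_side e A"
  have "\<exists>p. ?P p" using assms ex_cut_side by blast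
  then obtain p where p: "?P p" and least: "\<And>q. ?P q \<Longrightarrow> card (snd p) \<le> card (snd q)"
    using ex_has_least_nat[of ?P _ "\<lambda>p. card (snd p)"] by blast
  obtain e A where "p = (e, A)" by (cases p)
  with p least have e: "e \<in> separating_edges" and A: "cut_side e A"
    and least: "\<And>f B. f \<in> separating_edges \<Longrightarrow> cut_side f B \<Longrightarrow> card A \<le> card B" by auto
  obtain r t where r: "r \<in> A" and t: "t \<in> verts G - e - A" using A unfolding cut_side_def by blast
  have "finite A" using A unfolding cut_side_def by (meson finite_Diff finite_subset finite_verts)
  have "r \<notin> f" if f: "f \<in> separating_edges" for f
  proof
    assume "r \<in> f"
    obtain B where B: "cut_side f B" "t \<notin> B" using ex_cut_side[OF f] .
    have "B \<subseteq> A - {r}" by (rule side_nested[OF e A f B(1) \<open>r \<in> f\<close> r t B(2)])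
    then have "card B < card A" using r \<open>finite A\<close> by (intro psubset_card_mono) auto
    then show False using least[OF f B(1)] by simp
  qed
  moreover have "r \<in> verts G" using A r unfolding cut_side_def by blast
  ultimately show ?thesis using that by blast
qed

text \<open>
  Let \<open>A e\<close> be a largest side.  By \<open>side_disjoint_or_inside\<close>, the edges \<open>f\<close> whose sides help to cover \<open>A e\<close> meet
  \<open>A e\<close>.  Take such an \<open>f\<close> with \<open>A f\<close> largest and a point \<open>a\<close> of \<open>f\<close> in \<open>A e\<close>.  It is covered by some \<open>A g\<close>,
  and then \<open>side_nested\<close> makes \<open>A g\<close> larger than \<open>A f\<close>.
\<close>

lemma private_element_of_largest_side:
  assumes F: "F \<subseteq> separating_edges" "F \<noteq> {}"
    and side: "\<And>e. e \<in> F \<Longrightarrow> cut_side e (A e)"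
    and r: "r \<in> verts G" "\<And>e. e \<in> F \<Longrightarrow> r \<notin> e \<and> r \<notin> A e"
  shows "\<exists>e\<in>F. \<not> A e \<subseteq> \<Union>(A ` (F - {e}))"
proof -
  have fin: "finite F" using F(1) separating_edges_finite finite_subset by blast
  have finA: "finite (A e)" if "e \<in> F" for e
    using side[OF that] unfolding cut_side_def by (meson finite_Diff finite_subset finite_verts)
  obtain e where e: "e \<in> F" and "Max ((\<lambda>f. card (A f)) ` F) = card (A e)"
    using obtains_MAX[OF fin F(2)] .
  then have e_max: "card (A f) \<le> card (A e)" if "f \<in> F" for f
    using Max_ge[of "(\<lambda>f. card (A f)) ` F" "card (A f)"] fin that by simp
  have not_larger: "\<not> A e \<subset> A f" if "f \<in> F" for f
  proof
    assume "A e \<subset> A f"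
    then have "card (A e) < card (A f)" by (rule psubset_card_mono[OF finA[OF that]])
    then show False using e_max[OF that] by simp
  qed
  have meets: "g \<inter> A e \<noteq> {}" if g: "g \<in> F - {e}" "A e \<inter> A g \<noteq> {}" for g
    using side_disjoint_or_inside[of e "A e" g "A g"] not_larger[of g] g e F(1) side by blast
  have "\<not> A e \<subseteq> \<Union>(A ` (F - {e}))"
  proof
    assume cover: "A e \<subseteq> \<Union>(A ` (F - {e}))"
    define M where "M = {f \<in> F - {e}. f \<inter> A e \<noteq> {}}"
    have covered: "\<exists>g\<in>M. y \<in> A g" if y: "y \<in> A e" for y
    proof -
      obtain g where g: "g \<in> F - {e}" "y \<in> A g" using cover y by blast
      then have "g \<inter> A e \<noteq> {}" using y by (intro meets) auto
      then show ?thesis using g unfolding M_def by blast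
    qed
    obtain y where "y \<in> A e" using side[OF e] unfolding cut_side_def by blast
    then have "M \<noteq> {}" using covered by blast
    have "finite M" using fin unfolding M_def by simp
    then obtain f where f: "f \<in> M" and "Max ((\<lambda>g. card (A g)) ` M) = card (A f)"
      using obtains_MAX[OF _ \<open>M \<noteq> {}\<close>] by blast
    then have f_max: "card (A g) \<le> card (A f)" if "g \<in> M" for g
      using Max_ge[of "(\<lambda>g. card (A g)) ` M" "card (A g)"] \<open>finite M\<close> that by simp
    obtain a where a: "a \<in> f" "a \<in> A e" using f unfolding M_def by blast
    obtain g where g: "g \<in> M" "a \<in> A g" using covered[OF a(2)] by blast
    have gF: "g \<in> F" "f \<in> F" using f g(1) unfolding M_def by auto
    have "A f \<subseteq> A g - {a}"
      by (rule side_nested[of g "A g" f "A f" a r]) (use gF F(1) side r g a in auto)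
    then have "card (A f) < card (A g)"
      using finA[OF gF(1)] g(2) by (intro psubset_card_mono) auto
    then show False using f_max[OF g(1)] by simp
  qed
  then show ?thesis using e by blast
qed

text \<open>
  The pairs \<open>{r, y}\<close>, with \<open>y\<close> in one of the chosen sides, are at least as many as the separating edges.
  If some side opposite to a chosen one contains a vertex besides \<open>r\<close>, a crossing pair without \<open>r\<close> is one more.
  Otherwise all chosen sides have \<open>n - 3\<close> vertices, so they cannot be nested, and there is only
  one separating edge against \<open>n - 3 \<ge> 2\<close> pairs.  For \<open>n = 4\<close> this fails: the complete graph minus one edge
  has one pair of each kind.
\<close>

lemma card_separating_edges_less:
  assumes ne: "separating_edges \<noteq> {}"
  shows "card separating_edges < card nonseparating_nonedges"
proof -
  let ?F = separating_edges
  obtain r where r: "r \<in> verts G" and "r \<notin> \<Union>?F"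
    using vertex_off_separating_edges[OF ne] .
  then have rF: "r \<notin> e" if "e \<in> ?F" for e using that by blast
  have "\<forall>e\<in>?F. \<exists>A. cut_side e A \<and> r \<notin> A" using ex_cut_side by metis
  then obtain A where A: "\<And>e. e \<in> ?F \<Longrightarrow> cut_side e (A e)" and rA: "\<And>e. e \<in> ?F \<Longrightarrow> r \<notin> A e"
    by metis
  have finA: "finite (A e)" if "e \<in> ?F" for e
    using A[OF that] unfolding cut_side_def by (meson finite_Diff finite_subset finite_verts)
  let ?Y = "\<Union>(A ` ?F)"
  have finY: "finite ?Y" using separating_edges_finite finA by blast
  have FY: "card ?F \<le> card ?Y"
  proof (rule card_le_card_UN_if_private_elements[OF separating_edges_finite finA])
    fix F' assume "F' \<subseteq> ?F" "F' \<noteq> {}"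
    then show "\<exists>e\<in>F'. \<not> A e \<subseteq> \<Union>(A ` (F' - {e}))"
      by (rule private_element_of_largest_side[of _ _ r]) (use A r rF rA \<open>F' \<subseteq> ?F\<close> in auto)
  qed
  let ?Q = "(\<lambda>y. {r, y}) ` ?Y"
  have QP: "?Q \<subseteq> nonseparating_nonedges"
  proof
    fix p assume "p \<in> ?Q"
    then obtain e y where e: "e \<in> ?F" "y \<in> A e" "p = {r, y}" by blast
    then have "{y, r} \<in> nonseparating_nonedges"
      using crossing_pair[OF e(1) A[OF e(1)] e(2)] r rF rA by blast
    then show "p \<in> nonseparating_nonedges" using e(3) by (simp add: insert_commute)
  qed
  have "inj_on (\<lambda>y. {r, y}) ?Y" by (rule inj_onI) (auto simp: doubleton_eq_iff)
  then have cardQ: "card ?Q = card ?Y" by (rule card_image)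
  show ?thesis
  proof (cases "\<exists>e\<in>?F. verts G - e - A e \<noteq> {r}")
    case True
    then obtain e where e: "e \<in> ?F" "verts G - e - A e \<noteq> {r}" by blast
    have "r \<in> verts G - e - A e" using e(1) r rF rA by blast
    then obtain x where x: "x \<in> verts G - e - A e" "x \<noteq> r" using e(2) by blast
    obtain y where y: "y \<in> A e" using A[OF e(1)] unfolding cut_side_def by blast
    have "{y, x} \<in> nonseparating_nonedges" by (rule crossing_pair[OF e(1) A[OF e(1)] y x(1)])
    moreover have "{y, x} \<notin> ?Q" using x(2) rA[OF e(1)] y by (auto simp: doubleton_eq_iff)
    ultimately have "?Q \<subset> nonseparating_nonedges" using QP by blast
    then have "card ?Q < card nonseparating_nonedges"
      by (rule psubset_card_mono[OF nonseparating_nonedges_finite])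
    then show ?thesis using cardQ FY by simp
  next
    case False
    have cardA: "card (A e) = card (verts G) - 3" if e: "e \<in> ?F" for e
    proof -
      have "A e = verts G - insert r e"
        using A[OF e] False e unfolding cut_side_def by blast
      moreover have "card (insert r e) = 3"
        using card_separating_edge[OF e] rF[OF e] card.infinite[of e] by fastforce
      moreover have "insert r e \<subseteq> verts G" using separating_edge_subset[OF e] r by blast
      ultimately show ?thesis
        using card_Diff_subset[of "insert r e" "verts G"] finite_subset[OF _ finite_verts] by auto
    qed
    obtain e where e: "e \<in> ?F" using ne by blast
    have "f = e" if f: "f \<in> ?F" for f
    proof (rule ccontr)
      assume "f \<noteq> e"
      from separating_edges_diff[OF f e this] obtain a where a: "a \<in> f" "a \<notin> e" .
      have "a \<in> verts G - e" "a \<noteq> r" using a separating_edge_subset[OF f] rF[OF f] by blast+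
      moreover have "verts G - e - A e = {r}" using False e by simp
      ultimately have "a \<in> A e" by blast
      have "A f \<subseteq> A e - {a}"
        by (rule side_nested[OF e A[OF e] f A[OF f] a(1) \<open>a \<in> A e\<close>, of r])
          (use r rF rA e f in auto)
      then have "card (A f) < card (A e)"
        using finA[OF e] \<open>a \<in> A e\<close> by (intro psubset_card_mono) auto
      then show False using cardA e f by simp
    qed
    then have "?F = {e}" using e by blast
    then have "card ?F = 1" "card ?Y = card (verts G) - 3" using cardA e by auto
    moreover have "card ?Y \<le> card nonseparating_nonedges"
      using card_mono[OF nonseparating_nonedges_finite QP] cardQ by simp
    ultimately show ?thesis using size_ge_5 by linarith
  qed
qed

end

section \<open>Weighted safe sets\<close>

context graph
begin

lemma conn_set_complete:
  assumes "complete_graph G" "X \<subseteq> verts G" "X \<noteq> {}"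
  shows "conn_set X"
  using assms unfolding complete_digraph_def conn_set_def no_edge_def by blast

lemma le_weighted_safe_number_iff:
  assumes "verts G \<noteq> {}"
  shows "x \<le> weighted_safe_number G w \<longleftrightarrow> (\<forall>S. weighted_safe_set G w S \<longrightarrow> x \<le> sum w S)"
proof -
  let ?M = "{sum w S | S. weighted_safe_set G w S}"
  have "?M \<subseteq> sum w ` Pow (verts G)" unfolding weighted_safe_set_def by blast
  then have "finite ?M" by (rule finite_subset) simp
  moreover have "?M \<noteq> {}" using weighted_safe_set_verts[OF assms] by blast
  ultimately show ?thesis unfolding weighted_safe_number_def by (subst Min_ge_iff) auto
qed

lemma sum_verts_split: "S \<subseteq> verts G \<Longrightarrow> sum w (verts G) = sum w S + sum w (verts G - S)"
  using sum.subset_diff[of S "verts G" w] by (simp add: add.commute)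

lemma weighted_safe_set_half_complete:
  assumes compl: "complete_graph G" and safe: "weighted_safe_set G w S"
    and w: "\<And>v. v \<in> verts G \<Longrightarrow> 0 \<le> w v"
  shows "sum w (verts G - S) \<le> sum w S"
proof (cases "verts G - S = {}")
  case True
  then have "sum w (verts G - S) = 0" by (simp only: sum.empty)
  moreover have "0 \<le> sum w S"
    using safe w unfolding weighted_safe_set_def by (intro sum_nonneg) blast
  ultimately show ?thesis by simp
next
  case False
  have S: "S \<noteq> {}" "S \<subseteq> verts G" using safe unfolding weighted_safe_set_def by auto
  then obtain x y where xy: "x \<in> S" "y \<in> verts G - S" using False by blast
  then have "x \<rightarrow>\<^bsub>G\<^esub> y" using compl S unfolding complete_digraph_def by blast
  moreover have "conn_set S" "conn_set (verts G - S)"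
    using conn_set_complete[OF compl] S False by auto
  ultimately show ?thesis
    using safe_set_le[OF safe _ _ xy] by (simp add: components_conn_set)
qed

text \<open>
  With weight 1 on each of \<open>u\<close> and \<open>v\<close> and total weight 1 on the rest, the rest is safe if it is connected: its
  complement has the two components \<open>{u}\<close> and \<open>{v}\<close>.  It has a third of the total weight.
\<close>

lemma nonadj_cut_if_weighted_safe_number:
  assumes half: "\<forall>w\<in>weight_functions G. weighted_safe_number G w \<ge> sum w (verts G) / 2"
    and uv: "u \<in> verts G" "v \<in> verts G" "u \<noteq> v" "\<not> u \<rightarrow>\<^bsub>G\<^esub> v"
  shows "\<not> conn_set (verts G - {u, v})"
proof
  let ?X = "verts G - {u, v}"
  assume conn: "conn_set ?X"
  then have "?X \<noteq> {}" unfolding conn_set_def by blast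
  then have X: "0 < card ?X" by (simp add: card_gt_0_iff)
  define w :: "'a \<Rightarrow> real" where "w x = (if x \<in> {u, v} then 1 else 1 / card ?X)" for x
  have "w \<in> weight_functions G" using X unfolding weight_functions_def w_def by auto
  have sumX: "sum w ?X = 1"
  proof -
    have "sum w ?X = (\<Sum>x\<in>?X. 1 / card ?X)" by (rule sum.cong) (auto simp: w_def)
    also have "\<dots> = card ?X * (1 / card ?X)" by (rule sum_constant)
    also have "\<dots> = 1" using \<open>?X \<noteq> {}\<close> by simp
    finally show ?thesis .
  qed
  have uvX: "verts G - ?X = {u, v}" using uv by auto
  have "weighted_safe_set G w ?X"
    unfolding weighted_safe_set_def
  proof (intro conjI ballI impI)
    fix C D assume "C \<in> components (G \<restriction> ?X)" and "D \<in> components (G \<restriction> (verts G - ?X))"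
    then have C: "C = ?X" and D: "D \<subseteq> {u, v}" "conn_set D"
      using components_conn_set[OF conn] uvX unfolding components_induce by auto
    have "D \<noteq> {u, v}" using D(2) conn_set_pair[OF uv(3)] uv(4) by blast
    then have "D = {} \<or> D = {u} \<or> D = {v}" using D(1) by blast
    then have "sum w D \<le> 1" by (auto simp: w_def)
    then show "sum w D \<le> sum w C" using sumX C by simp
  qed (use \<open>?X \<noteq> {}\<close> in auto)
  moreover have "verts G \<noteq> {}" using uv by blast
  moreover have "sum w (verts G) / 2 \<le> weighted_safe_number G w"
    using half \<open>w \<in> weight_functions G\<close> by blast
  ultimately have "sum w (verts G) / 2 \<le> sum w ?X" using le_weighted_safe_number_iff by blast
  moreover have "sum w (verts G) = sum w ?X + sum w {u, v}"
    using sum_verts_split[of ?X w] uvX by simp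
  moreover have "sum w {u, v} = 2" using uv by (simp add: w_def)
  ultimately show False using sumX by simp
qed

end

section \<open>Connected sets of one or two vertices and their complements\<close>

context graph
begin

definition conn_subsets :: "nat \<Rightarrow> 'a set set" where
  "conn_subsets k = {X. X \<subseteq> verts G \<and> card X = k \<and> conn_set X}"

definition conn_complements :: "nat \<Rightarrow> 'a set set" where
  "conn_complements k = {X. X \<subseteq> verts G \<and> card X = k \<and> conn_set (verts G - X)}"

lemma finite_conn_subsets: "finite (conn_subsets k)" "finite (conn_complements k)"
  unfolding conn_subsets_def conn_complements_def by auto

lemma q_1: "q k 1 G = card (conn_subsets k)"
  unfolding q_def conn_subsets_def num_components_eq_1_iff ..

lemma q_diff_1:
  assumes "k \<le> card (verts G)"
  shows "q (card (verts G) - k) 1 G = card (conn_complements k)"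
proof -
  have card_diff: "card (verts G - X) = card (verts G) - card X" if "X \<subseteq> verts G" for X
    using that by (simp add: card_Diff_subset finite_subset[OF _ finite_verts])
  have "conn_subsets (card (verts G) - k) = (\<lambda>X. verts G - X) ` conn_complements k"
  proof (intro equalityI subsetI)
    fix X assume X: "X \<in> conn_subsets (card (verts G) - k)"
    then have "X = verts G - (verts G - X)" unfolding conn_subsets_def by auto
    moreover have "verts G - X \<in> conn_complements k"
      using X card_diff[of X] assms calculation
      unfolding conn_subsets_def conn_complements_def by auto
    ultimately show "X \<in> (\<lambda>X. verts G - X) ` conn_complements k" by (rule image_eqI)
  next
    fix X assume "X \<in> (\<lambda>X. verts G - X) ` conn_complements k"
    then show "X \<in> conn_subsets (card (verts G) - k)"
      using card_diff unfolding conn_subsets_def conn_complements_def by auto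
  qed
  moreover have "inj_on (\<lambda>X. verts G - X) (conn_complements k)"
    unfolding conn_complements_def by (rule inj_onI) blast
  ultimately show ?thesis unfolding q_1 by (simp add: card_image)
qed

lemma conn_set_iff_complement:
  assumes "complete_graph G \<or> cycle_graph G" "5 \<le> card (verts G)"
    and X: "X \<subseteq> verts G" "card X = 1 \<or> card X = 2"
  shows "conn_set X \<longleftrightarrow> conn_set (verts G - X)"
proof -
  have "X \<noteq> {}" using X(2) by auto
  have "card (verts G - X) \<noteq> 0"
    using assms(2) X by (auto simp: card_Diff_subset finite_subset[OF _ finite_verts])
  then have ne: "verts G - X \<noteq> {}" by force
  show ?thesis
    using assms(1)
  proof
    assume "complete_graph G"
    then show ?thesis using conn_set_complete X(1) \<open>X \<noteq> {}\<close> ne by blast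
  next
    assume "cycle_graph G"
    then obtain c where "chordless_cycle G c (card (verts G))"
      by (rule chordless_cycle_if_cycle_graph)
    then interpret chordless_cycle G c "card (verts G)" .
    show ?thesis
      using X(2)
    proof
      assume "card X = 1"
      then obtain v where "X = {v}" by (auto simp: card_1_singleton_iff)
      then show ?thesis using conn_set_singleton conn_set_verts_minus_vertex X(1) by simp
    next
      assume "card X = 2"
      then obtain u v where uv: "X = {u, v}" "u \<noteq> v" by (auto simp: card_2_iff)
      then show ?thesis
        using conn_set_pair[OF uv(2)] conn_set_verts_minus_edge[of u v] nonadj_cut[of u v] X(1)
        by auto
    qed
  qed
qed

text \<open>
  Connected pairs with disconnected complement are the separating edges, disconnected pairs with
  connected complement are the nonseparating nonedges.  Equality of the two counts for pairs means that there are as many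
  of the former as of the latter.
\<close>

lemma nonadj_cut_if_q_eq:
  assumes size: "5 \<le> card (verts G)"
    and q1: "q 1 1 G = q (card (verts G) - 1) 1 G"
    and q2: "q 2 1 G = q (card (verts G) - 2) 1 G"
    and uv: "u \<in> verts G" "v \<in> verts G" "u \<noteq> v" "\<not> u \<rightarrow>\<^bsub>G\<^esub> v"
  shows "\<not> conn_set (verts G - {u, v})"
proof
  assume conn: "conn_set (verts G - {u, v})"
  have le: "1 \<le> card (verts G)" "2 \<le> card (verts G)" using size by linarith+
  have card1: "card (conn_subsets 1) = card (conn_complements 1)"
    using q1 unfolding q_diff_1[OF le(1)] unfolding q_1 .
  have card2: "card (conn_subsets 2) = card (conn_complements 2)"
    using q2 unfolding q_diff_1[OF le(2)] unfolding q_1 .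
  have "conn_complements 1 \<subseteq> conn_subsets 1"
    unfolding conn_subsets_def conn_complements_def
    using conn_set_singleton by (auto simp: card_1_singleton_iff)
  then have eq1: "conn_complements 1 = conn_subsets 1"
    using card_subset_eq finite_conn_subsets card1 by metis
  have "conn_set (verts G - {x})" if "x \<in> verts G" for x
  proof -
    have "{x} \<in> conn_subsets 1" using that conn_set_singleton unfolding conn_subsets_def by auto
    then show ?thesis unfolding eq1[symmetric] unfolding conn_complements_def by blast
  qed
  then interpret no_cut_vertex G by unfold_locales (use size in auto)
  have sep: "separating_edges = conn_subsets 2 - conn_complements 2"
  proof (intro equalityI subsetI)
    fix e assume e: "e \<in> separating_edges"
    obtain s where "s \<in> e" using separating_edge_nonempty[OF e] by blast
    then have "\<not> conn_set (verts G - e)" using separating_edgeE[OF e] by blast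
    then show "e \<in> conn_subsets 2 - conn_complements 2"
      using separating_edge_subset[OF e] card_separating_edge[OF e] separating_edge_conn[OF e]
      unfolding conn_subsets_def conn_complements_def by blast
  next
    fix e assume e: "e \<in> conn_subsets 2 - conn_complements 2"
    then obtain x y where "e = {x, y}" "x \<noteq> y" unfolding conn_subsets_def by (auto simp: card_2_iff)
    then show "e \<in> separating_edges"
      using e conn_set_pair[of x y]
      unfolding conn_subsets_def conn_complements_def separating_edges_def by blast
  qed
  have nonsep: "nonseparating_nonedges = conn_complements 2 - conn_subsets 2"
  proof (intro equalityI subsetI)
    fix p assume "p \<in> nonseparating_nonedges"
    then obtain x y where "p = {x, y}" "x \<in> verts G" "y \<in> verts G" "x \<noteq> y" "\<not> x \<rightarrow>\<^bsub>G\<^esub> y"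
      "conn_set (verts G - {x, y})" unfolding nonseparating_nonedges_def by blast
    then show "p \<in> conn_complements 2 - conn_subsets 2"
      using conn_set_pair[of x y] unfolding conn_subsets_def conn_complements_def by auto
  next
    fix p assume p: "p \<in> conn_complements 2 - conn_subsets 2"
    then obtain x y where "p = {x, y}" "x \<noteq> y"
      unfolding conn_complements_def by (auto simp: card_2_iff)
    then show "p \<in> nonseparating_nonedges"
      using p conn_set_pair[of x y]
      unfolding conn_subsets_def conn_complements_def nonseparating_nonedges_def by blast
  qed
  have "card separating_edges = card nonseparating_nonedges"
    unfolding sep nonsep using card2 card_Int_Diff finite_conn_subsets
    by (metis Int_commute add_left_cancel)
  then have "separating_edges = {}" using card_separating_edges_less by fastforce
  then have "card nonseparating_nonedges = 0"
    using \<open>card separating_edges = card nonseparating_nonedges\<close> by simp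
  then have "nonseparating_nonedges = {}" using nonseparating_nonedges_finite by simp
  then show False using uv conn unfolding nonseparating_nonedges_def by blast
qed

end

section \<open>The four equivalent conditions\<close>

theorem theorem1p5:
  fixes G :: "('a, 'b) pre_digraph" and n :: nat
  assumes "graph G"
    and "connected_graph G"
    and "card (verts G) = n"
    and "n \<ge> 5"
  shows "((complete_graph G \<or> cycle_graph G) \<longleftrightarrow>
            (\<forall>w \<in> weight_functions G. weighted_safe_number G w \<ge> sum w (verts G) / 2))
       \<and> ((complete_graph G \<or> cycle_graph G) \<longleftrightarrow>
            (\<forall>u \<in> verts G. \<forall>v \<in> verts G. u \<noteq> v \<and> \<not> u \<rightarrow>\<^bsub>G\<^esub> v \<longrightarrow>
               \<not> connected_graph (G \<restriction> (verts G - {u, v}))))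
       \<and> ((complete_graph G \<or> cycle_graph G) \<longleftrightarrow>
            (q 1 1 G = q (n - 1) 1 G \<and> q 2 1 G = q (n - 2) 1 G))"
    (is "(?i \<longleftrightarrow> ?ii) \<and> (?i \<longleftrightarrow> ?iii) \<and> (?i \<longleftrightarrow> ?iv)")
proof -
  interpret graph G by (rule assms(1))
  have size: "5 \<le> card (verts G)" using assms by simp
  then have ne: "verts G \<noteq> {}" by auto
  have "G \<restriction> verts G = G" by (rule induce_eq_iff_induced[OF induced_subgraph_refl])
  then have conn: "conn_set (verts G)" using connected_induce_iff[of "verts G"] assms(2) by simp
  have iii_iff: "?iii \<longleftrightarrow> (\<forall>u\<in>verts G. \<forall>v\<in>verts G. u \<noteq> v \<longrightarrow> \<not> u \<rightarrow>\<^bsub>G\<^esub> v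
      \<longrightarrow> \<not> conn_set (verts G - {u, v}))"
    unfolding connected_induce_iff by blast
  have iii_i: ?i if ?iii
    by (rule complete_or_cycle_if_nonadj_cut[OF conn]) (use size that iii_iff in auto)
  have ii_iii: ?iii if ?ii
    unfolding iii_iff using nonadj_cut_if_weighted_safe_number[OF that] by blast
  have iv_iii: ?iii if ?iv
    unfolding iii_iff using nonadj_cut_if_q_eq[OF size] that assms(3) by blast
  have i_iii: ?iii if ?i
    using that
  proof
    assume "complete_graph G"
    then show ?iii unfolding complete_digraph_def by blast
  next
    assume "cycle_graph G"
    then obtain c where "chordless_cycle G c (card (verts G))"
      by (rule chordless_cycle_if_cycle_graph)
    then interpret chordless_cycle G c "card (verts G)" .
    show ?iii unfolding iii_iff using nonadj_cut by blast
  qed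
  have i_ii: ?ii if ?i
  proof
    fix w assume "w \<in> weight_functions G"
    then have w: "0 \<le> w v" if "v \<in> verts G" for v
      using that unfolding weight_functions_def by fastforce
    have half: "sum w (verts G - S) \<le> sum w S" if S: "weighted_safe_set G w S" for S
      using \<open>?i\<close>
    proof
      assume "complete_graph G"
      then show ?thesis by (rule weighted_safe_set_half_complete[OF _ S w])
    next
      assume "cycle_graph G"
      then obtain c where "chordless_cycle G c (card (verts G))"
        by (rule chordless_cycle_if_cycle_graph)
      then interpret chordless_cycle G c "card (verts G)" .
      show ?thesis by (rule weighted_safe_set_half[OF S w])
    qed
    have "sum w (verts G) / 2 \<le> sum w S" if S: "weighted_safe_set G w S" for S
      using half[OF S] sum_verts_split[of S w] S unfolding weighted_safe_set_def by simp
    then show "sum w (verts G) / 2 \<le> weighted_safe_number G w"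
      unfolding le_weighted_safe_number_iff[OF ne] by blast
  qed
  have i_iv: ?iv if ?i
  proof -
    have "conn_subsets k = conn_complements k" if "k = 1 \<or> k = 2" for k
      using conn_set_iff_complement[OF \<open>?i\<close> size] that
      unfolding conn_subsets_def conn_complements_def by blast
    then show ?iv
      using q_diff_1[of 1] q_diff_1[of 2] size assms(3) unfolding q_1 by simp
  qed
  show ?thesis using iii_i ii_iii iv_iii i_iii i_ii i_iv by argo
qed

end
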